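(* Let $\mathfrak{g}_3$ be the $15$-dimensional Lie algebra over the field $\mathbb{F}_3$ with $3$ elements, with basis $\{v_1,\ldots,v_{15}\}$ and the multiplication table given in the context. Then $\dim \mathrm{Der}(\mathfrak{g}_3)=45$, $\dim\mathrm{Inn}(\mathfrak{g}_3)=12$, and $\mathrm{AID}(\mathfrak{g}_3)=\mathrm{Inn}(\mathfrak{g}_3)\oplus U$ (as vector spaces) for some Lie subalgebra $U$ of dimension $21$ that contains the two linear maps $d_1,d_2\colon\mathfrak{g}_3\to\mathfrak{g}_3$ defined in the context, and these do not commute, that is, $[d_1,d_2]\neq 0$. In particular, the Lie algebra $\mathrm{AID}(\mathfrak{g}_3)/\mathrm{Inn}(\mathfrak{g}_3)$ is non-abelian; thus there exists a finite dimensional Lie algebra $\mathfrak{g}$ (over a field of positive characteristic) for which the quotient $\mathrm{AID}(\mathfrak{g})/\mathrm{Inn}(\mathfrak{g})$ of the almost-inner derivations modulo the inner derivations is non-abelian.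
   Context: For a finite dimensional Lie algebra $\mathfrak{g}$ over a field $F$: $\mathrm{Der}(\mathfrak{g})$ is the Lie algebra (under commutator) of all derivations, i.e. linear maps $\delta\colon\mathfrak{g}\to\mathfrak{g}$ with $\delta([a,b])=[\delta(a),b]+[a,\delta(b)]$ for all $a,b\in\mathfrak{g}$; $\mathrm{Inn}(\mathfrak{g})=\{\mathrm{ad}(a): a\in\mathfrak{g}\}$, where $\mathrm{ad}(a)(b)=[a,b]$, is the ideal of inner derivations; $\mathrm{AID}(\mathfrak{g})$ is the Lie subalgebra of $\mathrm{Der}(\mathfrak{g})$ of almost-inner derivations, i.e. those derivations $\delta$ such that $\delta(a)\in[\mathfrak{g},a]=\{[x,a]:x\in\mathfrak{g}\}$ for all $a\in\mathfrak{g}$. One has $\mathrm{Inn}(\mathfrak{g})\leq\mathrm{AID}(\mathfrak{g})\leq\mathrm{Der}(\mathfrak{g})$, with $\mathrm{Inn}(\mathfrak{g})$ an ideal. Multiplication table of $\mathfrak{g}_3$ (over $\mathbb{F}_3$; the bracket is extended bilinearly and by $[v_j,v_i]=-[v_i,v_j]$, $[v_i,v_i]=0$; every $[v_i,v_j]$ with $i<j$ that is not listed is $0$): $[v_1,v_2]=2v_7$, $[v_1,v_3]=v_7+2v_8$, $[v_1,v_4]=2v_{10}$, $[v_1,v_5]=v_{11}$, $[v_1,v_6]=v_{12}$, $[v_1,v_{10}]=2v_{13}$, $[v_1,v_{11}]=v_{14}+v_{15}$, $[v_1,v_{12}]=2v_{15}$, $[v_2,v_3]=2v_8+v_9$, $[v_2,v_4]=2v_{12}$,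 $[v_2,v_5]=2v_{10}+v_{12}$, $[v_2,v_6]=v_{11}$, $[v_2,v_{10}]=v_{13}+2v_{15}$, $[v_2,v_{11}]=v_{13}+2v_{14}+v_{15}$, $[v_2,v_{12}]=v_{14}+2v_{15}$, $[v_3,v_4]=2v_{11}$, $[v_3,v_5]=v_{11}+2v_{12}$, $[v_3,v_6]=2v_{10}+v_{12}$, $[v_3,v_{10}]=2v_{13}+v_{14}$, $[v_3,v_{11}]=v_{13}+2v_{14}+2v_{15}$, $[v_3,v_{12}]=v_{13}+v_{14}+2v_{15}$, $[v_4,v_7]=v_{13}$, $[v_4,v_8]=2v_{15}$, $[v_4,v_9]=v_{14}+v_{15}$, $[v_5,v_7]=v_{14}+v_{15}$, $[v_5,v_8]=2v_{13}+v_{15}$, $[v_5,v_9]=2v_{14}+v_{15}$, $[v_6,v_7]=2v_{15}$, $[v_6,v_8]=2v_{14}+2v_{15}$, $[v_6,v_9]=2v_{13}+v_{15}$. The linear maps $d_1,d_2$ (with $d_i(v_k)=0$ whenever not listed): $d_1(v_2)=v_7$, $d_1(v_3)=2v_7+v_8$, $d_1(v_4)=2v_{11}+2v_{12}$, $d_1(v_5)=2v_{10}$, $d_1(v_6)=v_{10}$, $d_1(v_{10})=v_{14}$, $d_1(v_{11})=v_{13}$, $d_1(v_{12})=2v_{13}$; $d_2(v_2)=v_{10}$, $d_2(v_7)=v_{13}$, $d_2(v_8)=v_{13}$, $d_2(v_9)=2v_{13}+2v_{14}$. *)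

theory Defs
  imports
    "HOL-Analysis.Analysis"
    "HOL-Library.Function_Algebras"
begin

section \<open>Lie algebras over a field\<close>

locale lie_algebra = vector_space scl
  for scl :: "'k::field \<Rightarrow> 'v::ab_group_add \<Rightarrow> 'v" +
  fixes bracket :: "'v \<Rightarrow> 'v \<Rightarrow> 'v"
  assumes linear_left: "Vector_Spaces.linear scl scl (\<lambda>x. bracket x y)"
    and linear_right: "Vector_Spaces.linear scl scl (\<lambda>y. bracket x y)"
    and alternating: "bracket x x = 0"
    and jacobi: "bracket x (bracket y z) + bracket y (bracket z x) + bracket z (bracket x y) = 0"

definition lie_subalgebra ::
  "('k::field \<Rightarrow> 'v::ab_group_add \<Rightarrow> 'v) \<Rightarrow> ('v \<Rightarrow> 'v \<Rightarrow> 'v) \<Rightarrow> 'v set \<Rightarrow> bool" where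
  "lie_subalgebra scl bracket S \<longleftrightarrow>
     module.subspace scl S \<and> (\<forall>x\<in>S. \<forall>y\<in>S. bracket x y \<in> S)"

definition coset :: "'v::ab_group_add set \<Rightarrow> 'v \<Rightarrow> 'v set" where
  "coset N x = {x + n | n. n \<in> N}"

definition quotient_carrier :: "'v::ab_group_add set \<Rightarrow> 'v set \<Rightarrow> 'v set set" where
  "quotient_carrier L N = coset N ` L"

text \<open>If \<open>N\<close> is an ideal of \<open>L\<close>, the union below is the single coset of \<open>[x, y]\<close>; see
  \<open>quotient_bracket_coset\<close>.\<close>

definition quotient_bracket ::
  "('v::ab_group_add \<Rightarrow> 'v \<Rightarrow> 'v) \<Rightarrow> 'v set \<Rightarrow> 'v set \<Rightarrow> 'v set \<Rightarrow> 'v set" where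
  "quotient_bracket bracket N X Y = (\<Union>x\<in>X. \<Union>y\<in>Y. coset N (bracket x y))"

definition quotient_abelian ::
  "('v::ab_group_add \<Rightarrow> 'v \<Rightarrow> 'v) \<Rightarrow> 'v set \<Rightarrow> 'v set \<Rightarrow> bool" where
  "quotient_abelian bracket L N \<longleftrightarrow>
     (\<forall>X\<in>quotient_carrier L N. \<forall>Y\<in>quotient_carrier L N.
        quotient_bracket bracket N X Y = coset N 0)"

section \<open>Derivations\<close>

text \<open>Linear maps are elements of the function space with its pointwise vector space structure;
  addition and subtraction come from \<^theory>\<open>HOL-Library.Function_Algebras\<close>.\<close>

definition map_scale :: "('k \<Rightarrow> 'v \<Rightarrow> 'v) \<Rightarrow> 'k \<Rightarrow> ('v \<Rightarrow> 'v) \<Rightarrow> 'v \<Rightarrow> 'v" where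
  "map_scale scl c f = (\<lambda>x. scl c (f x))"

definition commutator :: "('v::ab_group_add \<Rightarrow> 'v) \<Rightarrow> ('v \<Rightarrow> 'v) \<Rightarrow> 'v \<Rightarrow> 'v" where
  "commutator f g = (f \<circ> g) - (g \<circ> f)"

definition Der ::
  "('k::field \<Rightarrow> 'v::ab_group_add \<Rightarrow> 'v) \<Rightarrow> ('v \<Rightarrow> 'v \<Rightarrow> 'v) \<Rightarrow> ('v \<Rightarrow> 'v) set" where
  "Der scl bracket = {\<delta>. Vector_Spaces.linear scl scl \<delta> \<and>
     (\<forall>a b. \<delta> (bracket a b) = bracket (\<delta> a) b + bracket a (\<delta> b))}"

definition Inn :: "('v \<Rightarrow> 'v \<Rightarrow> 'v) \<Rightarrow> ('v \<Rightarrow> 'v) set" where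
  "Inn bracket = range (\<lambda>a. \<lambda>b. bracket a b)"

definition AID ::
  "('k::field \<Rightarrow> 'v::ab_group_add \<Rightarrow> 'v) \<Rightarrow> ('v \<Rightarrow> 'v \<Rightarrow> 'v) \<Rightarrow> ('v \<Rightarrow> 'v) set" where
  "AID scl bracket = {\<delta> \<in> Der scl bracket. \<forall>a. \<delta> a \<in> range (\<lambda>x. bracket x a)}"

lemma (in vector_space) vector_space_map_scale: "vector_space (map_scale scale)"
  by unfold_locales (auto simp: map_scale_def fun_eq_iff algebra_simps)

context lie_algebra
begin

lemma bracket_linear:
  "bracket (x + y) z = bracket x z + bracket y z"
  "bracket x (y + z) = bracket x y + bracket x z"
  "bracket (scl c x) z = scl c (bracket x z)"
  "bracket x (scl c y) = scl c (bracket x y)"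
  using linear_left linear_right by (simp_all add: Vector_Spaces.linear_iff)

lemma bracket_zero: "bracket 0 x = 0" "bracket x 0 = 0"
  using bracket_linear(3)[of 0 0 x] bracket_linear(4)[of x 0 0] by simp_all

lemma bracket_minus: "bracket (- x) y = - bracket x y" "bracket x (- y) = - bracket x y"
  using bracket_linear(3)[of "- 1" x y] bracket_linear(4)[of x "- 1" y] by simp_all

lemma bracket_diff:
  "bracket (x - y) z = bracket x z - bracket y z"
  "bracket x (y - z) = bracket x y - bracket x z"
  using bracket_linear(1)[of x "- y" z] bracket_linear(2)[of x y "- z"]
  by (simp_all add: bracket_minus)

lemma antisymmetric: "bracket y x = - bracket x y"
proof -
  have "bracket x y + bracket y x = 0"
    using alternating[of "x + y", unfolded bracket_linear]
    by (simp add: alternating add.commute)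
  then show ?thesis by (simp only: add_eq_0_iff)
qed

lemma Der_iff:
  "f \<in> Der scl bracket \<longleftrightarrow>
     (\<forall>x y. f (x + y) = f x + f y) \<and> (\<forall>c x. f (scl c x) = scl c (f x)) \<and>
     (\<forall>a b. f (bracket a b) = bracket (f a) b + bracket a (f b))"
  using vector_space_axioms by (auto simp: Der_def Vector_Spaces.linear_iff)

lemma Der_diff: "f (x - y) = f x - f y" if "f \<in> Der scl bracket"
  using that by (metis (no_types) Der_iff add_diff_cancel_right' diff_add_cancel)

lemma Inn_subset_AID: "Inn bracket \<subseteq> AID scl bracket"
proof
  fix f assume "f \<in> Inn bracket"
  then obtain a where f: "f = (\<lambda>b. bracket a b)" by (auto simp: Inn_def)
  have "bracket a (bracket x y) = bracket (bracket a x) y + bracket x (bracket a y)" for x y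
    using jacobi[of a x y] antisymmetric[of y "bracket a x"] antisymmetric[of a y]
    by (simp add: bracket_minus add_eq_0_iff algebra_simps)
  then show "f \<in> AID scl bracket"
    by (auto simp: f AID_def Der_iff bracket_linear)
qed

lemma lie_subalgebra_Der: "lie_subalgebra (map_scale scl) commutator (Der scl bracket)"
proof -
  interpret M: vector_space "map_scale scl" by (rule vector_space_map_scale)
  show ?thesis
    by (auto simp: lie_subalgebra_def M.subspace_def Der_iff Der_diff map_scale_def commutator_def
        bracket_linear bracket_zero bracket_diff algebra_simps)
qed

lemma commutator_inner:
  "commutator f (\<lambda>b. bracket a b) = (\<lambda>b. bracket (f a) b)" if "f \<in> Der scl bracket"
  using that by (auto simp: commutator_def Der_iff fun_eq_iff)

lemma lie_subalgebra_AID: "lie_subalgebra (map_scale scl) commutator (AID scl bracket)"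
proof -
  interpret M: vector_space "map_scale scl" by (rule vector_space_map_scale)
  let ?D = "Der scl bracket"
  have D: "0 \<in> ?D" "\<And>f g. f \<in> ?D \<Longrightarrow> g \<in> ?D \<Longrightarrow> f + g \<in> ?D"
    "\<And>c f. f \<in> ?D \<Longrightarrow> map_scale scl c f \<in> ?D"
    "\<And>f g. f \<in> ?D \<Longrightarrow> g \<in> ?D \<Longrightarrow> commutator f g \<in> ?D"
    using lie_subalgebra_Der by (auto simp: lie_subalgebra_def M.subspace_def)
  have 1: "\<exists>z. commutator f g a = bracket z a"
    if f: "f \<in> AID scl bracket" and g: "g \<in> AID scl bracket" for f g a
  proof -
    obtain x y where x: "f a = bracket x a" and y: "g a = bracket y a"
      using f g by (auto simp: AID_def image_iff) meson
    have fg: "f \<in> ?D" "g \<in> ?D" using f g by (auto simp: AID_def)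
    have J: "bracket y (bracket x a) - bracket x (bracket y a) = bracket (bracket y x) a"
      using jacobi[of y x a] antisymmetric[of a "bracket y x"] antisymmetric[of y a]
      by (simp add: bracket_minus add_eq_0_iff algebra_simps)
    have "commutator f g a = f (bracket y a) - g (bracket x a)"
      by (simp add: commutator_def x y)
    also have "\<dots> = bracket (f y) a + bracket y (bracket x a)
        - (bracket (g x) a + bracket x (bracket y a))"
      using fg by (simp add: Der_iff x y)
    also have "bracket (f y) a + bracket y (bracket x a)
        - (bracket (g x) a + bracket x (bracket y a)) = bracket (f y - g x + bracket y x) a"
      using J by (simp add: bracket_linear bracket_diff algebra_simps)
    finally show ?thesis by blast
  qed
  have 2: "\<exists>z. f a + g a = bracket z a"
    if "f \<in> AID scl bracket" "g \<in> AID scl bracket" for f g a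
    using that by (auto simp: AID_def image_iff) (metis bracket_linear(1))
  have 3: "\<exists>z. scl c (f a) = bracket z a" if "f \<in> AID scl bracket" for f c a
    using that by (auto simp: AID_def image_iff) (metis bracket_linear(3))
  have sub: "f \<in> ?D" if "f \<in> AID scl bracket" for f using that by (simp add: AID_def)
  have I: "f \<in> AID scl bracket" if "f \<in> ?D" "\<And>a. \<exists>z. f a = bracket z a" for f
    using that by (auto simp: AID_def image_iff)
  have "M.subspace (AID scl bracket)"
  proof (rule M.subspaceI)
    show "0 \<in> AID scl bracket"
      using D(1) by (rule I) (auto intro: exI[of _ 0] simp: bracket_zero)
    show "f + g \<in> AID scl bracket"
      if "f \<in> AID scl bracket" "g \<in> AID scl bracket" for f g
      using D(2)[OF that[THEN sub]] by (rule I) (simp add: 2[OF that])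
    show "map_scale scl c f \<in> AID scl bracket" if "f \<in> AID scl bracket" for c f
      using D(3)[OF sub[OF that]] by (rule I) (simp add: map_scale_def 3[OF that])
  qed
  moreover have "commutator f g \<in> AID scl bracket"
    if "f \<in> AID scl bracket" "g \<in> AID scl bracket" for f g
    using D(4)[OF that[THEN sub]] by (rule I) (rule 1[OF that])
  ultimately show ?thesis by (simp add: lie_subalgebra_def)
qed

lemma lie_subalgebra_Inn: "lie_subalgebra (map_scale scl) commutator (Inn bracket)"
proof -
  interpret M: vector_space "map_scale scl" by (rule vector_space_map_scale)
  have "M.subspace (Inn bracket)"
  proof (rule M.subspaceI)
    show "0 \<in> Inn bracket" by (auto simp: Inn_def fun_eq_iff bracket_zero intro!: image_eqI[of _ _ 0])
    fix f g c assume "f \<in> Inn bracket" "g \<in> Inn bracket"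
    then obtain x y where f: "f = (\<lambda>b. bracket x b)" and g: "g = (\<lambda>b. bracket y b)"
      by (auto simp: Inn_def)
    show "f + g \<in> Inn bracket"
      by (auto simp: Inn_def f g fun_eq_iff bracket_linear intro!: image_eqI[of _ _ "x + y"])
  next
    fix f c assume "f \<in> Inn bracket"
    then obtain x where f: "f = (\<lambda>b. bracket x b)" by (auto simp: Inn_def)
    show "map_scale scl c f \<in> Inn bracket"
      by (auto simp: Inn_def f map_scale_def fun_eq_iff bracket_linear
          intro!: image_eqI[of _ _ "scl c x"])
  qed
  moreover have "commutator f g \<in> Inn bracket" if "f \<in> Inn bracket" "g \<in> Inn bracket" for f g
    using that Inn_subset_AID by (auto simp: Inn_def AID_def commutator_inner subset_iff)
  ultimately show ?thesis by (simp add: lie_subalgebra_def)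
qed

lemma Inn_ideal:
  assumes "f \<in> Der scl bracket" "g \<in> Inn bracket"
  shows "commutator f g \<in> Inn bracket" and "commutator g f \<in> Inn bracket"
proof -
  interpret M: vector_space "map_scale scl" by (rule vector_space_map_scale)
  show *: "commutator f g \<in> Inn bracket"
    using assms by (auto simp: Inn_def commutator_inner)
  have "commutator g f = - commutator f g" by (simp add: commutator_def)
  then show "commutator g f \<in> Inn bracket"
    using * lie_subalgebra_Inn by (simp add: lie_subalgebra_def M.subspace_neg)
qed

lemma quotient_bracket_coset:
  assumes f: "f \<in> Der scl bracket" and g: "g \<in> Der scl bracket"
  shows "quotient_bracket commutator (Inn bracket) (coset (Inn bracket) f) (coset (Inn bracket) g)
    = coset (Inn bracket) (commutator f g)"
proof -
  interpret M: vector_space "map_scale scl" by (rule vector_space_map_scale)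
  let ?I = "Inn bracket"
  have S: "M.subspace ?I" using lie_subalgebra_Inn by (simp add: lie_subalgebra_def)
  have ID: "h \<in> Der scl bracket" if "h \<in> ?I" for h
    using that Inn_subset_AID by (auto simp: AID_def)
  have coset: "coset ?I (x + n) = coset ?I x" if "n \<in> ?I" for x n
  proof -
    have "\<exists>m'\<in>?I. x + m = x + n + m'" if "m \<in> ?I" for m
      using M.subspace_diff[OF S that \<open>n \<in> ?I\<close>] by (auto intro!: bexI[of _ "m - n"])
    moreover have "\<exists>m'\<in>?I. x + n + m = x + m'" if "m \<in> ?I" for m
      using M.subspace_add[OF S \<open>n \<in> ?I\<close> that] by (auto simp: add.assoc)
    ultimately show ?thesis by (fastforce simp: coset_def)
  qed
  have key: "coset ?I (commutator (f + n) (g + m)) = coset ?I (commutator f g)"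
    if n: "n \<in> ?I" and m: "m \<in> ?I" for n m
  proof -
    have "commutator (f + n) (g + m)
        = commutator f g + (commutator f m + commutator n g + commutator n m)"
      using f g ID[OF n] ID[OF m]
      by (auto simp: commutator_def fun_eq_iff Der_iff algebra_simps)
    moreover have "commutator f m + commutator n g + commutator n m \<in> ?I"
      by (intro M.subspace_add[OF S] Inn_ideal f g ID n m)
    ultimately show ?thesis by (simp add: coset)
  qed
  have "0 \<in> ?I" using S by (rule M.subspace_0)
  then show ?thesis
    unfolding quotient_bracket_def coset_def[of ?I f] coset_def[of ?I g] using key by blast
qed

end

section \<open>The Lie algebra \<open>\<gg>\<^sub>3\<close>\<close>

text \<open>The library type \<open>finite_3\<close> is the prime field with three elements.\<close>

type_synonym F3 = Enum.finite_3

type_synonym g3 = "F3 ^ 15"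

lemma card_F3: "CARD(F3) = 3"
  by (simp add: UNIV_finite_3)

text \<open>The index type \<open>15\<close> is the ring of integers modulo \<open>15\<close>, so \<open>of_nat\<close> maps
  \<open>{1..15}\<close> bijectively onto it (with \<open>of_nat 15 = 0\<close>).\<close>

definition bv :: "nat \<Rightarrow> g3" where
  "bv i = axis (of_nat i) 1"

definition linear_extension :: "(nat \<Rightarrow> g3) \<Rightarrow> g3 \<Rightarrow> g3" where
  "linear_extension t x = (\<Sum>i=1..15. (x $ of_nat i) *s t i)"

definition table_lookup :: "('i \<times> g3) list \<Rightarrow> 'i \<Rightarrow> g3" where
  "table_lookup l i = (case map_of l i of None \<Rightarrow> 0 | Some x \<Rightarrow> x)"

definition g3_table :: "((nat \<times> nat) \<times> g3) list" where
  "g3_table =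
    [((1, 2), 2 *s bv 7),
     ((1, 3), bv 7 + 2 *s bv 8),
     ((1, 4), 2 *s bv 10),
     ((1, 5), bv 11),
     ((1, 6), bv 12),
     ((1, 10), 2 *s bv 13),
     ((1, 11), bv 14 + bv 15),
     ((1, 12), 2 *s bv 15),
     ((2, 3), 2 *s bv 8 + bv 9),
     ((2, 4), 2 *s bv 12),
     ((2, 5), 2 *s bv 10 + bv 12),
     ((2, 6), bv 11),
     ((2, 10), bv 13 + 2 *s bv 15),
     ((2, 11), bv 13 + 2 *s bv 14 + bv 15),
     ((2, 12), bv 14 + 2 *s bv 15),
     ((3, 4), 2 *s bv 11),
     ((3, 5), bv 11 + 2 *s bv 12),
     ((3, 6), 2 *s bv 10 + bv 12),
     ((3, 10), 2 *s bv 13 + bv 14),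
     ((3, 11), bv 13 + 2 *s bv 14 + 2 *s bv 15),
     ((3, 12), bv 13 + bv 14 + 2 *s bv 15),
     ((4, 7), bv 13),
     ((4, 8), 2 *s bv 15),
     ((4, 9), bv 14 + bv 15),
     ((5, 7), bv 14 + bv 15),
     ((5, 8), 2 *s bv 13 + bv 15),
     ((5, 9), 2 *s bv 14 + bv 15),
     ((6, 7), 2 *s bv 15),
     ((6, 8), 2 *s bv 14 + 2 *s bv 15),
     ((6, 9), 2 *s bv 13 + bv 15)]"

definition g3_structure :: "nat \<Rightarrow> nat \<Rightarrow> g3" where
  "g3_structure i j =
     (if i < j then table_lookup g3_table (i, j)
      else if j < i then - table_lookup g3_table (j, i) else 0)"

definition g3_bracket :: "g3 \<Rightarrow> g3 \<Rightarrow> g3" where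
  "g3_bracket x y =
     (\<Sum>i=1..15. \<Sum>j=1..15. (x $ of_nat i * y $ of_nat j) *s g3_structure i j)"

definition d1 :: "g3 \<Rightarrow> g3" where
  "d1 = linear_extension (table_lookup
    [(2, bv 7), (3, 2 *s bv 7 + bv 8), (4, 2 *s bv 11 + 2 *s bv 12), (5, 2 *s bv 10),
     (6, bv 10), (10, bv 14), (11, bv 13), (12, 2 *s bv 13)])"

definition d2 :: "g3 \<Rightarrow> g3" where
  "d2 = linear_extension (table_lookup
    [(2, bv 10), (7, bv 13), (8, bv 13), (9, 2 *s bv 13 + 2 *s bv 14)])"

lemma of_nat_index_inj: "inj_on (of_nat :: nat \<Rightarrow> 15) {1..15}"
proof -
  have "{1..15::nat} = {1,2,3,4,5,6,7,8,9,10,11,12,13,14,15}"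
    by (auto simp: eval_nat_numeral atLeastAtMostSuc_conv)
  then show ?thesis by (simp add: inj_on_def)
qed

lemma range_bv: "bv ` {1..15} = (cart_basis :: g3 set)"
proof -
  have "of_nat ` {1..15} = (UNIV :: 15 set)"
    by (rule card_subset_eq) (simp_all only: card_image[OF of_nat_index_inj], simp_all)
  moreover have "bv ` {1..15} = (\<lambda>i. axis i 1) ` (of_nat ` {1..15})"
    unfolding bv_def by (rule image_image[symmetric])
  ultimately show ?thesis by (simp only: cart_basis_def) blast
qed

lemma bv_nth:
  assumes "i \<in> {1..15}" "k \<in> {1..15}"
  shows "bv i $ of_nat k = (if k = i then 1 else 0)"
  using assms inj_on_eq_iff[OF of_nat_index_inj assms] by (auto simp: bv_def axis_def)

lemma linear_extension_bv:
  assumes "i \<in> {1..15}"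
  shows "linear_extension t (bv i) = t i"
proof -
  have "linear_extension t (bv i) = (\<Sum>k=1..15. if k = i then t k else 0)"
    unfolding linear_extension_def
    by (intro sum.cong refl, subst bv_nth)
      (use assms in \<open>auto simp del: zero_finite_3_def one_finite_3_def\<close>)
  then show ?thesis using assms by simp
qed

lemma g3_bracket_bv:
  assumes "i \<in> {1..15}" "j \<in> {1..15}"
  shows "g3_bracket (bv i) (bv j) = g3_structure i j"
proof -
  have "g3_bracket (bv i) (bv j)
      = (\<Sum>k=1..15. \<Sum>l=1..15. if l = j then (if k = i then g3_structure k l else 0) else 0)"
    unfolding g3_bracket_def
    by (intro sum.cong refl, subst (1 2) bv_nth)
      (use assms in \<open>auto simp del: zero_finite_3_def one_finite_3_def\<close>)
  then show ?thesis using assms by simp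
qed

end

theory Submission
  imports Defs "HOL-Library.Code_Binary_Nat"
begin

text \<open>The algebra is graded, \<open>\<gg>\<^sub>3 = A \<oplus> B \<oplus> C \<oplus> D \<oplus> Z\<close>, with \<open>A = \<langle>v\<^sub>1, v\<^sub>2, v\<^sub>3\<rangle>\<close> in degree
  \<open>(1, 0)\<close> and the next triples of basis vectors in degrees \<open>(0, 1)\<close>, \<open>(2, 0)\<close>, \<open>(1, 1)\<close> and \<open>(2, 1)\<close>.
  The products \<open>A \<times> B \<rightarrow> D\<close>, \<open>A \<times> D \<rightarrow> Z\<close> and \<open>B \<times> C \<rightarrow> Z\<close> have no zero divisors. Hence \<open>[\<gg>\<^sub>3, v]\<close>
  contains \<open>Z\<close> for every \<open>v\<close> outside the centre \<open>Z\<close>, and contains \<open>D \<oplus> Z\<close> unless \<open>v\<close> lies in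
  \<open>C \<oplus> D \<oplus> Z\<close>, so that every derivation mapping \<open>A \<oplus> B\<close> into \<open>D \<oplus> Z\<close>, \<open>C \<oplus> D\<close> into \<open>Z\<close> and \<open>Z\<close> to \<open>0\<close>
  is almost inner.

  There are 45 linear forms on derivations that separate derivations. Twelve of them vanish on all
  almost-inner derivations, because \<open>\<delta>(v\<^sub>i) \<in> [\<gg>\<^sub>3, v\<^sub>i]\<close> for \<open>i \<le> 4\<close>; twelve are dual to
  \<open>ad v\<^sub>1, \<dots>, ad v\<^sub>1\<^sub>2\<close>, and their common kernel in the almost-inner derivations is the complement \<open>U\<close>;
  the remaining 21 are coordinates on \<open>U\<close>. Explicit derivations that are triangular with respect to
  these forms give all dimensions.\<close>

declare zero_finite_3_def [simp del] one_finite_3_def [simp del] two_finite_3 [simp del]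

section \<open>Triangular families of functionals and vectors\<close>

fun triangular :: "(('v \<Rightarrow> 'k::zero) \<times> 'v) list \<Rightarrow> bool" where
  "triangular [] \<longleftrightarrow> True"
| "triangular ((\<phi>, b) # ps) \<longleftrightarrow> \<phi> b \<noteq> 0 \<and> (\<forall>(_, c)\<in>set ps. \<phi> c = 0) \<and> triangular ps"

context vector_space
begin

lemma linear_functional:
  assumes "Vector_Spaces.linear scale (*) \<phi>"
  shows "\<phi> (x + y) = \<phi> x + \<phi> y" "\<phi> (x - y) = \<phi> x - \<phi> y" "\<phi> (scale c x) = c * \<phi> x" "\<phi> 0 = 0"
proof -
  interpret Vector_Spaces.linear scale "(*)" \<phi> by fact
  show "\<phi> (x + y) = \<phi> x + \<phi> y" "\<phi> (x - y) = \<phi> x - \<phi> y" "\<phi> (scale c x) = c * \<phi> x" "\<phi> 0 = 0"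
    by (simp_all add: add diff scale)
qed

lemma functional_zero_on_span:
  assumes "Vector_Spaces.linear scale (*) \<phi>" "x \<in> span S" "\<And>s. s \<in> S \<Longrightarrow> \<phi> s = 0"
  shows "\<phi> x = 0"
  using assms(2)
  by (induction rule: span_induct_alt) (simp_all add: linear_functional[OF assms(1)] assms(3))

text \<open>The first functional vanishes on the span of the later vectors but not on the first
  vector, which therefore lies outside that span.\<close>

lemma triangular_independent:
  assumes "triangular ps" "\<And>p. p \<in> set ps \<Longrightarrow> Vector_Spaces.linear scale (*) (fst p)"
  shows "independent (snd ` set ps) \<and> distinct (map snd ps)"
  using assms
proof (induction ps)
  case (Cons p ps)
  obtain \<phi> b where p: "p = (\<phi>, b)" by (cases p)
  have \<phi>: "Vector_Spaces.linear scale (*) \<phi>" using Cons.prems(2)[of p] by (simp add: p)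
  have "\<phi> x = 0" if "x \<in> span (snd ` set ps)" for x
    using Cons.prems(1) by (intro functional_zero_on_span[OF \<phi> that]) (auto simp: p)
  then have "b \<notin> span (snd ` set ps)" using Cons.prems(1) by (auto simp: p)
  moreover from this have "b \<notin> snd ` set ps" by (blast intro: span_base)
  ultimately show ?case using Cons by (simp add: p independent_insert)
qed (simp add: independent_empty)

text \<open>Gaussian elimination: a multiple of the first vector cancels the first functional, and
  the later corrections are invisible to that functional.\<close>

lemma triangular_approx:
  assumes "triangular ps" "\<And>p. p \<in> set ps \<Longrightarrow> Vector_Spaces.linear scale (*) (fst p)"
  shows "\<exists>f\<in>span (snd ` set ps). \<forall>p\<in>set ps. fst p (v - f) = 0"
  using assms
proof (induction ps arbitrary: v)
  case (Cons p ps)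
  obtain \<phi> b where p: "p = (\<phi>, b)" by (cases p)
  have \<phi>: "Vector_Spaces.linear scale (*) \<phi>" using Cons.prems(2)[of p] by (simp add: p)
  define g where "g = scale (\<phi> v / \<phi> b) b"
  have "\<exists>f\<in>span (snd ` set ps). \<forall>p\<in>set ps. fst p (v - g - f) = 0"
    using Cons.prems by (intro Cons.IH) (auto simp: p)
  then obtain f where f: "f \<in> span (snd ` set ps)" "\<forall>p\<in>set ps. fst p (v - g - f) = 0" by blast
  have "\<phi> f = 0"
    using Cons.prems(1) by (intro functional_zero_on_span[OF \<phi> f(1)]) (auto simp: p)
  then have "\<phi> (v - (g + f)) = 0"
    using Cons.prems(1) by (simp add: p g_def linear_functional[OF \<phi>])
  moreover have "f \<in> span (snd ` set (p # ps))"
    using span_mono[of "snd ` set ps" "snd ` set (p # ps)"] f(1) by auto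
  then have "g + f \<in> span (snd ` set (p # ps))"
    by (intro span_add) (auto intro: span_scale span_base simp: g_def p)
  ultimately show ?case using f(2) by (intro bexI[of _ "g + f"]) (simp_all add: p diff_diff_add)
qed (auto intro: span_zero)

text \<open>On a linear combination of the vectors, the first functional reads off a non-zero
  multiple of the first coefficient; so the coefficients vanish one after the other.\<close>

lemma triangular_span_zero:
  assumes "triangular ps" "\<And>p. p \<in> set ps \<Longrightarrow> Vector_Spaces.linear scale (*) (fst p)"
    and "v \<in> span (snd ` set ps)" "\<And>p. p \<in> set ps \<Longrightarrow> fst p v = 0"
  shows "v = 0"
  using assms
proof (induction ps)
  case (Cons p ps)
  obtain \<phi> b where p: "p = (\<phi>, b)" by (cases p)
  have \<phi>: "Vector_Spaces.linear scale (*) \<phi>" using Cons.prems(2)[of p] by (simp add: p)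
  obtain c where c: "v - scale c b \<in> span (snd ` set ps)"
    using Cons.prems(3) by (auto simp: p span_insert)
  have "\<phi> (v - scale c b) = 0"
    using Cons.prems(1) by (intro functional_zero_on_span[OF \<phi> c]) (auto simp: p)
  then have "c = 0"
    using Cons.prems(1) Cons.prems(4)[of p] by (simp add: p linear_functional[OF \<phi>])
  with c have "v \<in> span (snd ` set ps)" by simp
  then show ?case using Cons.prems by (intro Cons.IH) (simp_all add: p)
qed simp

text \<open>Independence comes from the triangular shape. Spanning comes from separation: the
  residue left by \<open>triangular_approx\<close> is killed by all functionals, hence zero.\<close>

lemma triangular_basis:
  assumes "subspace V" "snd ` set ps \<subseteq> V" "triangular ps"
    and lin: "\<And>p. p \<in> set ps \<Longrightarrow> Vector_Spaces.linear scale (*) (fst p)"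
    and zero: "\<And>v. v \<in> V \<Longrightarrow> (\<And>p. p \<in> set ps \<Longrightarrow> fst p v = 0) \<Longrightarrow> v = 0"
  shows "span (snd ` set ps) = V" and "dim V = length ps"
proof -
  have sub: "span (snd ` set ps) \<subseteq> V" by (rule span_minimal) fact+
  moreover have "v \<in> span (snd ` set ps)" if "v \<in> V" for v
  proof -
    obtain f where f: "f \<in> span (snd ` set ps)" "\<forall>p\<in>set ps. fst p (v - f) = 0"
      using triangular_approx[OF assms(3) lin] by blast
    then have "v - f = 0"
      using that sub by (intro zero subspace_diff[OF assms(1)]) auto
    with f show ?thesis by simp
  qed
  ultimately show *: "span (snd ` set ps) = V" by blast
  have "independent (snd ` set ps) \<and> distinct (map snd ps)"
    by (rule triangular_independent) fact+
  then have "dim V = card (snd ` set ps)" "card (snd ` set ps) = length ps"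
    using dim_eq_card[of "snd ` set ps" V] distinct_card[of "map snd ps"]
    by (simp_all add: * span_eq_iff[THEN iffD2, OF assms(1)])
  then show "dim V = length ps" by simp
qed

end

section \<open>Sparse vectors and maps\<close>

type_synonym 'i sparse = "('i \<times> F3) list"

text \<open>Indices may repeat and their coefficients add up, so concatenation is addition and no
  normal form is needed.\<close>

fun coef :: "('i \<times> 'a::comm_monoid_add) list \<Rightarrow> 'i \<Rightarrow> 'a" where
  "coef [] k = 0"
| "coef ((i, c) # u) k = (if i = k then c + coef u k else coef u k)"

definition smult :: "'a::times \<Rightarrow> ('i \<times> 'a) list \<Rightarrow> ('i \<times> 'a) list" where
  "smult c u = map (\<lambda>(i, a). (i, c * a)) u"

fun null :: "('i \<times> 'a::comm_monoid_add) list \<Rightarrow> bool" where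
  "null [] \<longleftrightarrow> True"
| "null ((i, c) # u) \<longleftrightarrow> c + coef u i = 0 \<and> null (filter (\<lambda>(j, _). j \<noteq> i) u)"

definition lookup :: "('i \<times> 'a list) list \<Rightarrow> 'i \<Rightarrow> 'a list" where
  "lookup t i = (case map_of t i of None \<Rightarrow> [] | Some u \<Rightarrow> u)"

lemma coef_append [simp]: "coef (u @ w) k = coef u k + coef w k"
  by (induction u k rule: coef.induct) (auto simp: add.assoc)

lemma coef_smult [simp]: "coef (smult c u) k = c * coef u k" for c :: "'a::comm_semiring_0"
  by (induction u) (auto simp: smult_def algebra_simps)

lemma coef_notin: "k \<notin> fst ` set u \<Longrightarrow> coef u k = 0"
  by (induction u) auto

lemma coef_null: "null u \<Longrightarrow> coef u k = 0"
proof (induction u rule: null.induct)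
  case (2 i c u)
  have "coef (filter (\<lambda>(j, _). j \<noteq> i) u) k = coef u k" if "i \<noteq> k"
    using that by (induction u) auto
  with 2 show ?case by (cases "i = k") auto
qed simp

lemma (in module) sparse_sum:
  assumes "finite K" "fst ` set u \<subseteq> K"
  shows "(\<Sum>(i, c)\<leftarrow>u. scale c (f i)) = (\<Sum>i\<in>K. scale (coef u i) (f i))"
  using assms(2)
proof (induction u)
  case (Cons p u)
  obtain i c where p: "p = (i, c)" by (cases p)
  have "(\<Sum>j\<in>K. scale (if i = j then c else 0) (f j)) = (\<Sum>j\<in>K. if i = j then scale c (f j) else 0)"
    by (intro sum.cong) auto
  also have "\<dots> = scale c (f i)" using Cons.prems assms(1) by (simp add: p)
  finally have "(\<Sum>j\<in>K. scale (if i = j then c else 0) (f j)) = scale c (f i)" .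
  moreover have "(\<Sum>j\<in>K. scale (coef (p # u) j) (f j))
      = (\<Sum>j\<in>K. scale (if i = j then c else 0) (f j) + scale (coef u j) (f j))"
    by (intro sum.cong) (auto simp: p scale_left_distrib)
  ultimately show ?case using Cons by (simp add: p sum.distrib)
qed simp

lemma (in module) sparse_sum_null:
  assumes "null u"
  shows "(\<Sum>(i, c)\<leftarrow>u. scale c (f i)) = 0"
  using sparse_sum[of "fst ` set u" u f] coef_null[OF assms] by simp

lemma (in module) sparse_sum_smult:
  "(\<Sum>(i, a)\<leftarrow>smult c u. scale a (f i)) = scale c (\<Sum>(i, a)\<leftarrow>u. scale a (f i))"
  by (induction u) (auto simp: smult_def scale_right_distrib)

section \<open>Data for \<open>\<gg>\<^sub>3\<close>\<close>

text \<open>A sparse map lists the images of the basis vectors. A form lists the weights of the matrix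
  entries \<open>(i, k)\<close>, the coefficient of \<open>v\<^sub>k\<close> in the image of \<open>v\<^sub>i\<close>.\<close>

type_synonym smap = "(nat \<times> nat sparse) list"
type_synonym form = "(nat \<times> nat) sparse"

text \<open>The multiplication table once more, grouped by the first index and in a form that can be
  evaluated; \<open>table_lookup_g3_table\<close> links it to \<open>g3_table\<close>.\<close>

definition g3_rows :: "(nat \<times> (nat \<times> nat sparse) list) list" where
  "g3_rows = [
     (1, [(2, [(7,2)]), (3, [(7,1), (8,2)]), (4, [(10,2)]), (5, [(11,1)]), (6, [(12,1)]),
       (10, [(13,2)]), (11, [(14,1), (15,1)]), (12, [(15,2)])]),
     (2, [(3, [(8,2), (9,1)]), (4, [(12,2)]), (5, [(10,2), (12,1)]), (6, [(11,1)]),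
       (10, [(13,1), (15,2)]), (11, [(13,1), (14,2), (15,1)]), (12, [(14,1), (15,2)])]),
     (3, [(4, [(11,2)]), (5, [(11,1), (12,2)]), (6, [(10,2), (12,1)]), (10, [(13,2), (14,1)]),
       (11, [(13,1), (14,2), (15,2)]), (12, [(13,1), (14,1), (15,2)])]),
     (4, [(7, [(13,1)]), (8, [(15,2)]), (9, [(14,1), (15,1)])]),
     (5, [(7, [(14,1), (15,1)]), (8, [(13,2), (15,1)]), (9, [(14,2), (15,1)])]),
     (6, [(7, [(15,2)]), (8, [(14,2), (15,2)]), (9, [(13,2), (15,1)])])]"

text \<open>The factor 2 is the sign of antisymmetry, as 2 = -1 in characteristic 3.\<close>

definition struct :: "nat \<Rightarrow> nat \<Rightarrow> nat sparse" where
  "struct i j =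
     (if i < j then lookup (lookup g3_rows i) j
      else if j < i then smult 2 (lookup (lookup g3_rows j) i) else [])"

definition sapply :: "(nat \<Rightarrow> nat sparse) \<Rightarrow> nat sparse \<Rightarrow> nat sparse" where
  "sapply t u = concat (map (\<lambda>(i, a). smult a (t i)) u)"

definition sad :: "nat \<Rightarrow> smap" where
  "sad i = map (\<lambda>j. (j, struct i j)) [1..<16]"

text \<open>Vectors are indexed modulo 15, so an index outside this range would silently denote
  another basis vector.\<close>

definition valid :: "nat sparse \<Rightarrow> bool" where
  "valid u \<longleftrightarrow> list_all (\<lambda>(i, _). 1 \<le> i \<and> i \<le> 15) u"

text \<open>Signs are avoided by swapping arguments: the three blocks are \<delta>[v_i, v_j],
  [v_j, \<delta> v_i] and [\<delta> v_j, v_i], whose sum is the Leibniz defect.\<close>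

definition derivation_check :: "smap \<Rightarrow> bool" where
  "derivation_check M \<longleftrightarrow> list_all (\<lambda>(_, u). valid u) M \<and>
     list_all (\<lambda>i. list_all (\<lambda>j.
       null (sapply (lookup M) (struct i j) @ sapply (struct j) (lookup M i)
         @ sapply (\<lambda>k. struct k i) (lookup M j))) [i+1..<16]) [1..<16]"

definition form_value :: "form \<Rightarrow> (nat \<Rightarrow> nat sparse) \<Rightarrow> F3" where
  "form_value w t = (\<Sum>((i, k), c)\<leftarrow>w. c * coef (t i) k)"

definition valid_form :: "form \<Rightarrow> bool" where
  "valid_form w \<longleftrightarrow> list_all (\<lambda>((i, k), _). 1 \<le> i \<and> i \<le> 15 \<and> 1 \<le> k \<and> k \<le> 15) w"

fun triangular_check :: "(form \<times> smap) list \<Rightarrow> bool" where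
  "triangular_check [] \<longleftrightarrow> True"
| "triangular_check ((w, M) # ps) \<longleftrightarrow> form_value w (lookup M) \<noteq> 0 \<and>
     list_all (\<lambda>(_, N). form_value w (lookup N) = 0) ps \<and> triangular_check ps"

datatype eqn = Bracket nat nat nat | Functional nat

text \<open>The \<open>l\<close>-th coordinate of \<open>\<delta>[v\<^sub>i, v\<^sub>j] - [\<delta> v\<^sub>i, v\<^sub>j] - [v\<^sub>i, \<delta> v\<^sub>j]\<close>, where \<open>2 = -1\<close>.\<close>

definition derivation_form :: "nat \<Rightarrow> nat \<Rightarrow> nat \<Rightarrow> form" where
  "derivation_form i j l =
     (if list_all (\<lambda>k. 1 \<le> k \<and> k \<le> 15) [i, j, l] then
        map (\<lambda>(k, c). ((k, l), c)) (struct i j) @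
        filter (\<lambda>(_, c). c \<noteq> 0) (concat (map (\<lambda>k. [((i, k), 2 * coef (struct k j) l),
          ((j, k), 2 * coef (struct i k) l)]) [1..<16]))
      else [])"

fun eqn_form :: "form list \<Rightarrow> eqn \<Rightarrow> form" where
  "eqn_form ws (Bracket i j l) = derivation_form i j l"
| "eqn_form ws (Functional n) = (if n < length ws then ws ! n else [])"

text \<open>Each step combines equations so that, modulo the entries \<open>K\<close> already known to vanish, only the
  entry \<open>x\<close> survives; then \<open>x\<close> vanishes too.\<close>

fun propagate :: "form list \<Rightarrow> (nat \<times> nat) list \<Rightarrow> ((nat \<times> nat) \<times> (eqn \<times> F3) list) list
    \<Rightarrow> (nat \<times> nat) list" where
  "propagate ws K [] = K"
| "propagate ws K ((x, es) # steps) =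
     (let w = filter (\<lambda>(y, _). y \<notin> set K) (concat (map (\<lambda>(e, c). smult c (eqn_form ws e)) es))
      in if coef w x \<noteq> 0 \<and> list_all (\<lambda>(y, _). y = x \<or> coef w y = 0) w
         then propagate ws (x # K) steps else K)"

text \<open>The thresholds express \<open>A \<oplus> B \<rightarrow> D \<oplus> Z\<close>, \<open>C \<oplus> D \<rightarrow> Z\<close> and \<open>Z \<rightarrow> 0\<close>.\<close>

definition central_type :: "(nat \<Rightarrow> nat sparse) \<Rightarrow> bool" where
  "central_type t \<longleftrightarrow> list_all (\<lambda>i. list_all (\<lambda>(k, _).
     (if i \<le> 6 then 10 else if i \<le> 12 then 13 else 16) \<le> k \<or> coef (t i) k = 0) (t i)) [1..<16]"

definition scommutator :: "smap \<Rightarrow> smap \<Rightarrow> nat \<Rightarrow> nat sparse" where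
  "scommutator M N i =
     sapply (lookup M) (lookup N i) @ smult 2 (sapply (lookup N) (lookup M i))"

text \<open>In the three families below a form is nonzero on the derivation that it is paired with, and zero
  on all later ones. The forms of the first family vanish on almost-inner derivations; those of the
  second are paired with \<open>ad v\<^sub>i\<close>; in the third, the first and fourth derivations are \<open>d\<^sub>1\<close> and \<open>d\<^sub>2\<close>.\<close>

definition outer_family :: "(form \<times> smap) list" where
  "outer_family = [
    ([((1,1),1)],
     [(1, [(1,1)]), (2, [(2,1)]), (3, [(3,1)]), (7, [(7,2)]), (8, [(8,2)]), (9, [(9,2)]),
      (10, [(10,1)]), (11, [(11,1)]), (12, [(12,1)]), (13, [(13,2)]), (14, [(14,2)]),
      (15, [(15,2)])]),
    ([((1,2),1)],
     [(1, [(2,1)]), (2, [(3,1)]), (3, [(1,2), (2,1)]), (7, [(7,2), (8,1)]), (8, [(8,2), (9,2)]),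
      (9, [(7,2), (8,2), (9,2)]), (10, [(12,1)]), (11, [(10,2), (12,1)]), (12, [(11,1)]),
      (13, [(13,2), (15,2)]), (14, [(13,2), (14,1)]), (15, [(14,1)])]),
    ([((1,3),1)],
     [(1, [(3,1)]), (2, [(1,2), (2,1)]), (3, [(2,2), (3,1)]), (7, [(7,1), (8,2), (9,1)]),
      (8, [(7,2), (9,1)]), (9, [(7,1), (8,2)]), (10, [(11,1)]), (11, [(11,1), (12,2)]),
      (12, [(10,2), (12,1)]), (13, [(13,1), (14,1), (15,2)]), (14, [(14,1), (15,2)]),
      (15, [(13,1), (14,2), (15,2)])]),
    ([((4,4),1)],
     [(4, [(4,1)]), (5, [(5,1)]), (6, [(6,1)]), (10, [(10,1)]), (11, [(11,1)]), (12, [(12,1)]),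
      (13, [(13,1)]), (14, [(14,1)]), (15, [(15,1)])]),
    ([((4,5),1)],
     [(4, [(5,1)]), (5, [(5,2), (6,1)]), (6, [(4,2), (6,2)]), (10, [(11,2)]),
      (11, [(11,2), (12,1)]), (12, [(10,1), (12,2)]), (13, [(14,1), (15,1)]),
      (14, [(13,2), (14,2), (15,2)]), (15, [(13,1), (15,2)])]),
    ([((4,6),1)],
     [(4, [(6,1)]), (5, [(4,2), (6,2)]), (6, [(5,2)]), (10, [(12,2)]), (11, [(10,1), (12,2)]),
      (12, [(11,2)]), (13, [(15,2)]), (14, [(13,2), (14,2)]), (15, [(14,1), (15,1)])]),
    ([((4,7),1)],
     [(4, [(7,1)]), (5, [(9,1)]), (6, [(8,1)])]),
    ([((4,8),1)],
     [(4, [(8,1)]), (5, [(7,2), (8,2)]), (6, [(9,2)])]),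
    ([((4,9),1)],
     [(4, [(9,1)]), (5, [(8,1), (9,2)]), (6, [(7,2), (8,2)])]),
    ([((1,9),1)],
     [(1, [(9,1)]), (2, [(8,1), (9,2)]), (3, [(7,2), (8,2), (9,2)]), (5, [(10,1), (11,1)]),
      (6, [(10,1), (11,2)]), (10, [(14,1), (15,1)]), (11, [(13,2), (14,2)]),
      (12, [(14,2), (15,1)])]),
    ([((2,8),1), ((2,9),1)],
     [(2, [(9,1)]), (3, [(7,2), (8,2), (9,2)]), (5, [(10,1), (11,2), (12,2)]), (6, [(11,1)]),
      (11, [(13,2), (14,2)]), (12, [(14,1), (15,1)])]),
    ([((3,7),1), ((3,8),1), ((3,9),1)],
     [(2, [(8,1), (9,2)]), (3, [(7,1)]), (5, [(10,2)]), (6, [(11,2), (12,1)]), (11, [(13,1)]),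
      (12, [(14,2), (15,1)])])]"

definition inner_indices :: "(form \<times> nat) list" where
  "inner_indices = [
     ([((1,8),1)], 3), ([((1,7),1)], 2), ([((4,10),1), ((4,11),2), ((4,12),1)], 1),
     ([((1,10),1)], 4), ([((1,11),1)], 5), ([((1,12),1)], 6), ([((1,14),1)], 11),
     ([((1,13),1)], 10), ([((1,15),1)], 12), ([((5,14),1), ((6,14),1), ((6,15),1)], 8),
     ([((4,13),1), ((6,15),1)], 9), ([((5,15),1), ((6,13),2)], 7)]"

definition inner_family :: "(form \<times> smap) list" where
  "inner_family = map (\<lambda>(w, i). (w, sad i)) inner_indices"

definition complement_family :: "(form \<times> smap) list" where
  "complement_family = [
    ([((2,7),1)],
     [(2, [(7,1)]), (3, [(7,2), (8,1)]), (4, [(11,2), (12,2)]), (5, [(10,2)]), (6, [(10,1)]),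
      (10, [(14,1)]), (11, [(13,1)]), (12, [(13,2)])]),
    ([((4,10),1)],
     [(4, [(10,1), (12,2)]), (5, [(10,1), (12,1)]), (6, [(10,1), (11,1), (12,1)]),
      (10, [(13,1), (15,2)]), (11, [(13,2), (15,2)]), (12, [(13,2), (14,1)])]),
    ([((4,11),1)],
     [(4, [(11,1), (12,1)]), (5, [(10,2), (12,1)]), (6, [(10,1)]), (10, [(14,2)]),
      (11, [(13,1), (15,2)]), (12, [(13,2)])]),
    ([((2,10),1)],
     [(2, [(10,1)]), (7, [(13,1)]), (8, [(13,1)]), (9, [(13,2), (14,2)])]),
    ([((2,11),1)],
     [(2, [(11,1)]), (7, [(14,2), (15,2)]), (8, [(14,2), (15,2)]), (9, [(13,2)])]),
    ([((2,12),1)],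
     [(2, [(12,1)]), (7, [(15,1)]), (8, [(15,1)]), (9, [(13,2), (14,2), (15,2)])]),
    ([((2,13),1)],
     [(2, [(13,1)])]),
    ([((2,14),1)],
     [(2, [(14,1)])]),
    ([((2,15),1)],
     [(2, [(15,1)])]),
    ([((3,10),1)],
     [(3, [(10,1)]), (8, [(13,1)]), (9, [(13,2), (15,2)])]),
    ([((3,11),1)],
     [(3, [(11,1)]), (8, [(14,2), (15,2)]), (9, [(13,1), (14,1)])]),
    ([((3,12),1)],
     [(3, [(12,1)]), (8, [(15,1)]), (9, [(14,1)])]),
    ([((3,13),1)],
     [(3, [(13,1)])]),
    ([((3,14),1)],
     [(3, [(14,1)])]),
    ([((3,15),1)],
     [(3, [(15,1)])]),
    ([((4,14),1)],
     [(4, [(14,1)])]),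
    ([((4,15),1)],
     [(4, [(15,1)])]),
    ([((5,13),1)],
     [(5, [(13,1)])]),
    ([((5,15),1)],
     [(5, [(15,1)]), (6, [(13,1)])]),
    ([((6,15),1)],
     [(4, [(13,2)]), (5, [(14,2)]), (6, [(15,1)])]),
    ([((6,14),1)],
     [(5, [(14,2)]), (6, [(14,1)])])]"

text \<open>\<open>Functional n\<close> refers to \<open>all_families\<close>: 0 to 11 are the outer
  forms, 12 to 23 the inner ones, 24 to 44 those of the complement. The order of the steps matters,
  since each may use the entries already eliminated.\<close>

definition certificate :: "((nat \<times> nat) \<times> (eqn \<times> F3) list) list" where
  "certificate = [
     ((10,9), [(Bracket 1 4 9, 1)]), ((11,9), [(Bracket 1 5 9, 1)]),
     ((12,9), [(Bracket 1 6 9, 1)]), ((4,3), [(Bracket 2 4 9, 1)]), ((5,3), [(Bracket 2 5 9, 1)]),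
     ((6,3), [(Bracket 2 6 9, 1)]), ((4,2), [(Bracket 3 4 9, 1)]), ((5,2), [(Bracket 3 5 9, 1)]),
     ((6,2), [(Bracket 3 6 9, 1)]), ((5,1), [(Bracket 4 5 10, 1)]),
     ((4,1), [(Bracket 4 5 11, 1)]), ((6,1), [(Bracket 4 6 10, 1)]), ((1,1), [(Functional 0, 1)]),
     ((1,2), [(Functional 1, 1)]), ((1,3), [(Functional 2, 1)]), ((4,4), [(Functional 3, 1)]),
     ((4,5), [(Functional 4, 1)]), ((4,6), [(Functional 5, 1)]), ((4,7), [(Functional 6, 1)]),
     ((4,8), [(Functional 7, 1)]), ((4,9), [(Functional 8, 1)]), ((1,9), [(Functional 9, 1)]),
     ((1,8), [(Functional 12, 1)]), ((1,7), [(Functional 13, 1)]), ((1,10), [(Functional 15, 1)]),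
     ((1,11), [(Functional 16, 1)]), ((1,12), [(Functional 17, 1)]),
     ((1,14), [(Functional 18, 1)]), ((1,13), [(Functional 19, 1)]),
     ((1,15), [(Functional 20, 1)]), ((2,7), [(Functional 24, 1)]),
     ((4,10), [(Functional 25, 1)]), ((4,11), [(Functional 26, 1)]),
     ((2,10), [(Functional 27, 1)]), ((2,11), [(Functional 28, 1)]),
     ((2,12), [(Functional 29, 1)]), ((2,13), [(Functional 30, 1)]),
     ((2,14), [(Functional 31, 1)]), ((2,15), [(Functional 32, 1)]),
     ((3,10), [(Functional 33, 1)]), ((3,11), [(Functional 34, 1)]),
     ((3,12), [(Functional 35, 1)]), ((3,13), [(Functional 36, 1)]),
     ((3,14), [(Functional 37, 1)]), ((3,15), [(Functional 38, 1)]),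
     ((4,14), [(Functional 39, 1)]), ((4,15), [(Functional 40, 1)]),
     ((5,13), [(Functional 41, 1)]), ((5,15), [(Functional 42, 1)]),
     ((6,15), [(Functional 43, 1)]), ((6,14), [(Functional 44, 1)]),
     ((7,9), [(Bracket 1 2 9, 1)]), ((8,9), [(Bracket 1 3 9, 1)]),
     ((10,10), [(Bracket 1 4 10, 1)]), ((10,11), [(Bracket 1 4 11, 1)]),
     ((10,12), [(Bracket 1 4 12, 1)]), ((10,13), [(Bracket 1 4 13, 1)]),
     ((10,14), [(Bracket 1 4 14, 1)]), ((13,13), [(Bracket 1 10 13, 1)]),
     ((13,14), [(Bracket 1 10 14, 1)]), ((13,15), [(Bracket 1 10 15, 1)]),
     ((12,13), [(Bracket 2 4 13, 1)]), ((5,7), [(Bracket 4 5 13, 1)]),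
     ((5,9), [(Bracket 4 5 14, 1)]), ((5,8), [(Bracket 4 5 15, 1)]),
     ((6,7), [(Bracket 4 6 13, 1)]), ((6,9), [(Bracket 4 6 14, 1)]),
     ((6,8), [(Bracket 4 6 15, 1)]), ((7,7), [(Bracket 4 7 13, 1)]),
     ((7,8), [(Bracket 4 7 15, 1)]), ((15,14), [(Bracket 4 8 14, 1)]),
     ((6,5), [(Bracket 6 7 14, 1)]), ((4,12), [(Functional 14, 1)]),
     ((5,14), [(Functional 21, 1)]), ((4,13), [(Functional 22, 1)]),
     ((6,13), [(Functional 23, 1)]), ((2,3), [(Bracket 1 2 8, 1)]),
     ((12,11), [(Bracket 1 6 11, 1)]), ((6,10), [(Bracket 1 6 13, 1)]),
     ((11,10), [(Bracket 2 6 10, 1)]), ((3,1), [(Bracket 3 4 10, 1)]),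
     ((2,2), [(Bracket 1 2 7, 1)]), ((5,4), [(Bracket 1 5 10, 1)]),
     ((12,12), [(Bracket 2 4 12, 1)]), ((5,5), [(Bracket 2 5 12, 1)]),
     ((15,15), [(Bracket 2 10 15, 1)]), ((14,14), [(Bracket 2 12 14, 1)]),
     ((3,3), [(Bracket 3 10 14, 1)]), ((8,8), [(Bracket 4 8 15, 1)]),
     ((15,13), [(Bracket 5 8 13, 1)]), ((6,4), [(Bracket 6 7 13, 1)]),
     ((6,6), [(Bracket 6 7 15, 1)]), ((9,8), [(Bracket 6 9 14, 1)]),
     ((2,1), [(Bracket 2 3 8, 1)]), ((5,6), [(Bracket 2 5 11, 1)]),
     ((11,12), [(Bracket 2 6 12, 1)]), ((3,2), [(Bracket 3 4 12, 1)]),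
     ((11,15), [(Bracket 1 5 15, 1), (Bracket 2 5 14, 1), (Bracket 2 4 14, 1)]),
     ((11,14), [(Bracket 2 6 15, 1), (Functional 10, 2), (Bracket 2 6 14, 1)]),
     ((5,11), [(Bracket 1 5 14, 1)]), ((5,12), [(Bracket 1 5 15, 1)]),
     ((3,9), [(Bracket 3 4 14, 1)]), ((3,8), [(Bracket 3 4 15, 1)]),
     ((3,7), [(Functional 11, 1)]), ((11,13), [(Bracket 3 4 13, 1)]),
     ((5,10), [(Bracket 1 5 13, 1)]), ((2,8), [(Bracket 2 5 13, 1)]),
     ((12,14), [(Bracket 3 5 14, 1)]), ((6,11), [(Bracket 1 6 14, 1)]),
     ((2,9), [(Bracket 2 4 14, 1)]), ((12,15), [(Bracket 2 4 15, 1)]),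
     ((6,12), [(Bracket 1 6 15, 1)]),
     ((7,10), [(Bracket 1 2 10, 1), (Bracket 2 7 13, 1), (Bracket 1 7 14, 2)]),
     ((1,4), [(Bracket 1 7 13, 1)]),
     ((7,12), [(Bracket 2 7 14, 1), (Bracket 1 2 12, 2), (Bracket 2 7 15, 2), (Bracket 1 7 14, 2)]),
     ((3,6), [(Bracket 3 7 15, 1), (Bracket 3 7 14, 2)]),
     ((1,6), [(Bracket 1 7 14, 1), (Bracket 1 7 15, 2)]), ((8,11), [(Bracket 1 8 14, 1)]),
     ((3,5), [(Bracket 1 7 14, 1), (Bracket 1 3 11, 1)]), ((7,11), [(Bracket 3 7 14, 1)]),
     ((2,5), [(Bracket 1 2 11, 1)]), ((1,5), [(Bracket 1 3 11, 1)]),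
     ((2,4), [(Bracket 1 2 10, 1)]), ((2,6), [(Bracket 1 2 12, 1)]),
     ((8,10), [(Bracket 1 8 13, 1)]), ((3,4), [(Bracket 1 3 10, 1)])]"

section \<open>Finite checks of the data by evaluation\<close>

definition all_families where "all_families = outer_family @ inner_family @ complement_family"

text \<open>This is the Jacobi identity on basis vectors, in the form that each ad v_i is a
  derivation.\<close>

lemma sad_check: "list_all (\<lambda>i. derivation_check (sad i)) [1..<16]"
  by code_simp

lemma outer_check: "list_all (\<lambda>(_, M). derivation_check M) outer_family"
  by code_simp

lemma complement_check: "list_all (\<lambda>(_, M). derivation_check M) complement_family"
  by code_simp

text \<open>Checking the concatenated list also yields that the outer forms vanish on the inner and
  complement derivations, and the inner forms on the complement derivations.\<close>

lemma triangular_all: "triangular_check all_families"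
  by code_simp

text \<open>Rows 1 to 6 suffice, because v_1, ..., v_6 generate the algebra and a derivation is
  determined on generators.\<close>

lemma certificate_check:
  "let K = propagate (map fst all_families) [] certificate
   in list_all (\<lambda>i. list_all (\<lambda>k. (i, k) \<in> set K) [1..<16]) [1..<7]"
  by code_simp

lemma valid_forms: "list_all (\<lambda>(w, _). valid_form w) all_families"
  by code_simp

text \<open>Each outer form sees the image of one basis vector only; at a single vector an
  almost-inner derivation agrees with an inner one.\<close>

lemma outer_forms_check: "list_all (\<lambda>(w, _).
    list_all (\<lambda>((i, _), _). i = fst (fst (hd w))) w) outer_family"
  by code_simp

text \<open>The map \<open>d\<^sub>1\<close> acts from \<open>A\<close> to \<open>C\<close> as \<open>- ad v\<^sub>1\<close>, so it is \<open>d\<^sub>1 + ad v\<^sub>1\<close> that satisfies the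
  criterion.\<close>

lemma central_type_check:
  "central_type (\<lambda>i. lookup (snd (hd complement_family)) i @ struct 1 i)"
  "list_all (\<lambda>(_, M). central_type (lookup M)) (tl complement_family)"
  by code_simp+

text \<open>Prepares the closure of the complement under commutators. Pairs in list order are
  enough, as the commutator is antisymmetric.\<close>

lemma scommutator_check: "sorted_wrt (\<lambda>M N. list_all (\<lambda>(w, _). form_value w (scommutator M N) = 0)
    inner_indices) (map snd complement_family)"
  by code_simp

section \<open>Coordinates\<close>

definition co :: "g3 \<Rightarrow> nat \<Rightarrow> F3" where
  "co x i = x $ of_nat i"

lemma co_simps [simp]:
  "co (x + y) i = co x i + co y i" "co (x - y) i = co x i - co y i" "co (- x) i = - co x i"
  "co (c *s x) i = c * co x i" "co 0 i = 0" "co (sum f A) i = (\<Sum>a\<in>A. co (f a) i)"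
  by (simp_all add: co_def)

lemma co_bv: "i \<in> {1..15} \<Longrightarrow> k \<in> {1..15} \<Longrightarrow> co (bv i) k = (if i = k then 1 else 0)"
  by (simp only: co_def bv_nth) auto

lemma g3_eqI:
  assumes "\<And>i. i \<in> {1..15} \<Longrightarrow> co x i = co y i"
  shows "x = y"
proof -
  have "of_nat ` {1..15} = (UNIV :: 15 set)"
    by (rule card_subset_eq) (simp_all only: card_image[OF of_nat_index_inj], simp_all)
  then show ?thesis
    using assms by (metis (no_types, lifting) UNIV_I co_def imageE vec_eq_iff)
qed

lemma minus_eq_2: "- 1 = (2 :: F3)"
  by code_simp

lemma g3_span: "x \<in> vec.span (bv ` {1..15})"
  by (simp only: range_bv span_cart_basis UNIV_I)

lemma g3_linear_eqI:
  assumes "Vector_Spaces.linear (*s) (*s) f" "Vector_Spaces.linear (*s) (*s) g"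
    and "\<And>i. i \<in> {1..15} \<Longrightarrow> f (bv i) = g (bv i)"
  shows "f = g"
proof
  fix x
  have "f b = g b" if "b \<in> bv ` {1..15}" for b
    using that by (elim imageE) (simp only: assms(3))
  then show "f x = g x" by (rule vec.linear_eq_on_span[OF assms(1,2) _ g3_span])
qed

lemma g3_linearI:
  fixes f :: "g3 \<Rightarrow> g3"
  assumes "\<And>x y. f (x + y) = f x + f y" "\<And>c x. f (c *s x) = c *s f x"
  shows "Vector_Spaces.linear (*s) (*s) f"
  using assms by (simp add: Vector_Spaces.linear_iff vec.vector_space_axioms)

lemma g3_linearD:
  fixes f :: "g3 \<Rightarrow> g3"
  assumes "Vector_Spaces.linear (*s) (*s) f"
  shows "f (x + y) = f x + f y" "f (x - y) = f x - f y" "f (- x) = - f x" "f (c *s x) = c *s f x"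
    "f 0 = 0"
proof -
  interpret Vector_Spaces.linear "(*s)" "(*s)" f by fact
  show "f (x + y) = f x + f y" "f (x - y) = f x - f y" "f (- x) = - f x" "f (c *s x) = c *s f x"
    "f 0 = 0"
    by (simp_all add: add diff neg scale)
qed

definition sv :: "nat sparse \<Rightarrow> g3" where
  "sv u = (\<Sum>(i, c)\<leftarrow>u. c *s bv i)"

lemma sv_simps [simp]:
  "sv [] = 0" "sv ((i, c) # u) = c *s bv i + sv u" "sv (u @ w) = sv u + sv w"
  by (simp_all add: sv_def)

lemma sv_smult [simp]: "sv (smult c u) = c *s sv u"
  unfolding sv_def by (rule vec.sparse_sum_smult)

lemma sv_null: "null u \<Longrightarrow> sv u = 0"
  unfolding sv_def by (rule vec.sparse_sum_null)

lemma valid_simps [simp]: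
  "valid []" "valid ((i, c) # u) \<longleftrightarrow> i \<in> {1..15} \<and> valid u" "valid (u @ w) \<longleftrightarrow> valid u \<and> valid w"
  by (auto simp: valid_def)

lemma co_sv:
  assumes "valid u" "k \<in> {1..15}"
  shows "co (sv u) k = coef u k"
  using assms(1) by (induction u) (auto simp: co_bv[OF _ assms(2)])

definition lin :: "smap \<Rightarrow> g3 \<Rightarrow> g3" where
  "lin M = linear_extension (\<lambda>i. sv (lookup M i))"

lemma linear_linear_extension: "Vector_Spaces.linear (*s) (*s) (linear_extension t)"
  by (rule g3_linearI)
    (simp_all add: linear_extension_def vec.scale_left_distrib sum.distrib vec.scale_sum_right)

lemmas linear_lin = linear_linear_extension[of "\<lambda>i. sv (lookup M i)" for M, folded lin_def]

lemma lin_bv: "i \<in> {1..15} \<Longrightarrow> lin M (bv i) = sv (lookup M i)"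
  unfolding lin_def by (rule linear_extension_bv)

lemma lin_sv:
  assumes "valid u"
  shows "lin M (sv u) = sv (sapply (lookup M) u)"
  using assms
  by (induction u) (auto simp: sapply_def g3_linearD[OF linear_lin] lin_bv)

section \<open>The bracket\<close>

lemma g3_bracket_co:
  "g3_bracket x y = (\<Sum>i=1..15. \<Sum>j=1..15. (co x i * co y j) *s g3_structure i j)"
  unfolding g3_bracket_def co_def ..

lemma g3_bracket_linear:
  "Vector_Spaces.linear (*s) (*s) (\<lambda>x. g3_bracket x y)"
  "Vector_Spaces.linear (*s) (*s) (\<lambda>y. g3_bracket x y)"
  by (rule g3_linearI;
      simp add: g3_bracket_co sum.distrib distrib_left distrib_right vec.scale_left_distrib
        vec.scale_sum_right mult_ac)+

lemmas g3_bracket_simps =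
  g3_linearD[OF g3_bracket_linear(1)] g3_linearD[OF g3_bracket_linear(2)]

text \<open>Flattens a nested table. Distinct row indices ensure that an entry missing from the
  selected row is not supplied by a later row.\<close>

lemma table_lookup_rows:
  fixes t :: "(nat \<times> (nat \<times> nat sparse) list) list"
  assumes "distinct (map fst t)"
  shows "table_lookup (concat (map (\<lambda>(i, r). map (\<lambda>(j, u). ((i, j), sv u)) r) t)) (i, j)
    = sv (lookup (lookup t i) j)"
proof -
  have 1: "map_of (map (\<lambda>(j, u). ((i', j), sv u)) r) (i, j)
      = (if i = i' then map_option sv (map_of r j) else None)" for i' and r :: "(nat \<times> nat sparse) list"
    by (induction r) auto
  have 2: "map_of (concat (map (\<lambda>(i, r). map (\<lambda>(j, u). ((i, j), sv u)) r) t)) (i, j) = None"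
    if "i \<notin> fst ` set t" for t
    using that by (induction t) (auto simp: 1 map_add_def)
  have "map_of (concat (map (\<lambda>(i, r). map (\<lambda>(j, u). ((i, j), sv u)) r) t)) (i, j)
      = map_option sv (map_of (lookup t i) j)"
    using assms
  proof (induction t)
    case (Cons p t)
    then show ?case
      using 2[of t] by (cases p) (auto simp: 1 map_add_def lookup_def split: option.splits)
  qed (simp add: lookup_def)
  then show ?thesis by (simp add: table_lookup_def lookup_def split: option.splits)
qed

lemma table_lookup_g3_table: "table_lookup g3_table (i, j) = sv (lookup (lookup g3_rows i) j)"
proof -
  have "g3_table = concat (map (\<lambda>(i, r). map (\<lambda>(j, u). ((i, j), sv u)) r) g3_rows)"
    by (simp add: g3_table_def g3_rows_def)
  moreover have "distinct (map fst g3_rows)" by (simp add: g3_rows_def)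
  ultimately show ?thesis using table_lookup_rows[of g3_rows i j] by simp
qed

lemma g3_structure_eq: "g3_structure i j = sv (struct i j)"
  by (simp add: g3_structure_def struct_def table_lookup_g3_table flip: minus_eq_2)

lemma g3_bracket_struct:
  "i \<in> {1..15} \<Longrightarrow> j \<in> {1..15} \<Longrightarrow> g3_bracket (bv i) (bv j) = sv (struct i j)"
  by (simp only: g3_bracket_bv g3_structure_eq)

lemma valid_struct_check: "list_all (\<lambda>(_, r). list_all (\<lambda>(_, u). valid u) r) g3_rows"
  by code_simp

lemma valid_smult [simp]: "valid (smult c u) = valid u"
  by (induction u) (auto simp: smult_def)

lemma lookup_cases: "lookup t i = [] \<or> (i, lookup t i) \<in> set t"
  by (auto simp: lookup_def map_of_SomeD split: option.splits)

lemma valid_struct: "valid (struct i j)"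
proof -
  have "valid (lookup (lookup g3_rows i) j)" for i j
    using valid_struct_check lookup_cases[of g3_rows i] lookup_cases[of "lookup g3_rows i" j]
    by (auto simp: list_all_iff lookup_def[of "[]"])
  then show ?thesis by (simp add: struct_def)
qed

lemma sparse_bracket:
  assumes "i \<in> {1..15}" "valid u"
  shows "g3_bracket (bv i) (sv u) = sv (sapply (struct i) u)"
    and "g3_bracket (sv u) (bv i) = sv (sapply (\<lambda>k. struct k i) u)"
proof -
  have *: "sapply t [] = []" "sapply t ((k, c) # u) = smult c (t k) @ sapply t u" for t k c u
    by (simp_all add: sapply_def)
  show "g3_bracket (bv i) (sv u) = sv (sapply (struct i) u)"
    using assms(2) by (induction u) (auto simp: * g3_bracket_simps g3_bracket_struct[OF assms(1)])
  show "g3_bracket (sv u) (bv i) = sv (sapply (\<lambda>k. struct k i) u)"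
    using assms(2) by (induction u) (auto simp: * g3_bracket_simps g3_bracket_struct[OF _ assms(1)])
qed

lemma g3_bracket_antisym: "g3_bracket y x = - g3_bracket x y"
proof -
  have "(co y i * co x j) *s g3_structure i j = - ((co x j * co y i) *s g3_structure j i)" for i j
    by (simp add: g3_structure_def mult.commute)
  then have "g3_bracket y x = (\<Sum>i=1..15. \<Sum>j=1..15. - ((co x j * co y i) *s g3_structure j i))"
    by (simp only: g3_bracket_co)
  also have "\<dots> = - (\<Sum>j=1..15. \<Sum>i=1..15. (co x j * co y i) *s g3_structure j i)"
    unfolding sum_negf by (subst sum.swap) (rule refl)
  finally show ?thesis by (simp only: g3_bracket_co)
qed

text \<open>Uses that 2 is invertible in the field; antisymmetry thereby becomes
  alternation.\<close>

lemma eq_minus_self: "x = - x \<Longrightarrow> x = 0" for x :: g3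
proof (rule g3_eqI)
  fix i assume "x = - x"
  then have "co x i = - co x i" by (metis co_simps(3))
  then show "co x i = co 0 i"
    by (cases "co x i") (auto simp: uminus_finite_3_def zero_finite_3_def)
qed

text \<open>The Leibniz defect \<open>D\<close> is bilinear and antisymmetric, so it vanishes once
  it vanishes on pairs of basis vectors with increasing indices.\<close>

lemma Der_g3I:
  assumes "Vector_Spaces.linear (*s) (*s) f"
    and "\<And>i j. i \<in> {1..15} \<Longrightarrow> j \<in> {1..15} \<Longrightarrow> i < j \<Longrightarrow>
      f (g3_bracket (bv i) (bv j)) = g3_bracket (f (bv i)) (bv j) + g3_bracket (bv i) (f (bv j))"
  shows "f \<in> Der (*s) g3_bracket"
proof -
  note f = g3_linearD[OF assms(1)]
  define D where "D a b = f (g3_bracket a b) - g3_bracket (f a) b - g3_bracket a (f b)" for a b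
  have D_sym: "D b a = - D a b" for a b
    by (simp add: D_def g3_bracket_antisym[of a b] g3_bracket_antisym[of "f a" b]
        g3_bracket_antisym[of a "f b"] f)
  have lin1: "Vector_Spaces.linear (*s) (*s) (\<lambda>a. D a b)" for b
    by (rule g3_linearI) (simp_all add: D_def f g3_bracket_simps vec.scale_right_diff_distrib)
  have lin2: "Vector_Spaces.linear (*s) (*s) (D a)" for a
    by (rule g3_linearI) (simp_all add: D_def f g3_bracket_simps vec.scale_right_diff_distrib)
  have lin0: "Vector_Spaces.linear (*s) (*s) (\<lambda>a::g3. 0::g3)" by (rule g3_linearI) simp_all
  have *: "D (bv i) (bv j) = 0" if "i \<in> {1..15}" "j \<in> {1..15}" "i < j" for i j
    using assms(2)[OF that] by (simp add: D_def)
  have "D (bv i) (bv j) = 0" if "i \<in> {1..15}" "j \<in> {1..15}" for i j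
  proof (cases i j rule: linorder_cases)
    case less
    then show ?thesis using that by (intro *)
  next
    case equal
    then show ?thesis using eq_minus_self[OF D_sym[of "bv i" "bv i"]] by simp
  next
    case greater
    then have "D (bv j) (bv i) = 0" using that by (intro *)
    then show ?thesis using D_sym[of "bv j" "bv i"] by simp
  qed
  then have "D (bv i) = (\<lambda>b. 0)" if "i \<in> {1..15}" for i
    using that by (intro g3_linear_eqI lin2 lin0) auto
  then have "(\<lambda>a. D a b) = (\<lambda>a. 0)" for b
    by (intro g3_linear_eqI lin1 lin0) auto
  then have "D a b = 0" for a b by meson
  then show ?thesis
    using assms(1) by (auto simp: Der_def D_def algebra_simps)
qed

lemma lin_Der:
  assumes "derivation_check M"
  shows "lin M \<in> Der (*s) g3_bracket"
proof (rule Der_g3I[OF linear_lin])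
  fix i j :: nat assume ij: "i \<in> {1..15}" "j \<in> {1..15}" "i < j"
  note check = assms[unfolded derivation_check_def list_all_iff set_upt]
  have valid: "valid (lookup M k)" for k
    using conjunct1[OF check] lookup_cases[of M k] by auto
  let ?w = "sapply (lookup M) (struct i j) @ sapply (struct j) (lookup M i)
    @ sapply (\<lambda>k. struct k i) (lookup M j)"
  have "null ?w" using conjunct2[OF check] ij by auto
  moreover have "sv ?w = lin M (g3_bracket (bv i) (bv j)) +
      (g3_bracket (bv j) (lin M (bv i)) + g3_bracket (lin M (bv j)) (bv i))"
    using ij by (simp add: g3_bracket_struct lin_sv valid_struct lin_bv valid sparse_bracket)
  ultimately have "lin M (g3_bracket (bv i) (bv j)) -
      (g3_bracket (lin M (bv i)) (bv j) + g3_bracket (bv i) (lin M (bv j))) = 0"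
    by (simp add: sv_null g3_bracket_antisym[of "bv j"] g3_bracket_antisym[of _ "bv i"]
        algebra_simps del: sv_simps)
  then show "lin M (g3_bracket (bv i) (bv j)) =
      g3_bracket (lin M (bv i)) (bv j) + g3_bracket (bv i) (lin M (bv j))"
    by simp
qed

lemma lookup_sad: "j \<in> {1..15} \<Longrightarrow> lookup (sad i) j = struct i j"
  unfolding sad_def lookup_def map_of_map_restrict restrict_map_def set_upt
  by (simp only: comp_def atLeastLessThan_iff atLeastAtMost_iff) auto

lemma lin_sad: "i \<in> {1..15} \<Longrightarrow> lin (sad i) = g3_bracket (bv i)"
  by (rule g3_linear_eqI[OF linear_lin g3_bracket_linear(2)])
    (simp add: lin_bv lookup_sad g3_bracket_struct)

text \<open>By \<open>sad_check\<close> the Leibniz form of the Jacobi identity holds when the first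
  argument is a basis vector; it extends by linearity, and antisymmetry gives the cyclic
  form.\<close>

lemma lie_algebra_g3: "lie_algebra (*s) g3_bracket"
proof
  show "g3_bracket x x = 0" for x
    by (rule eq_minus_self) (rule g3_bracket_antisym)
  have "g3_bracket (bv i) (g3_bracket y z)
      = g3_bracket (g3_bracket (bv i) y) z + g3_bracket y (g3_bracket (bv i) z)"
    if "i \<in> {1..15}" for i y z
    using that sad_check[unfolded list_all_iff set_upt] lin_Der[of "sad i"]
    by (simp add: lin_sad Der_def)
  then have "(\<lambda>x. g3_bracket x (g3_bracket y z))
      = (\<lambda>x. g3_bracket (g3_bracket x y) z + g3_bracket y (g3_bracket x z))" for y z
    by (intro g3_linear_eqI g3_linearI) (auto simp: g3_bracket_simps algebra_simps vec.scale_right_distrib)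
  then have *: "g3_bracket x (g3_bracket y z)
      = g3_bracket (g3_bracket x y) z + g3_bracket y (g3_bracket x z)" for x y z
    by meson
  show "g3_bracket x (g3_bracket y z) + g3_bracket y (g3_bracket z x)
      + g3_bracket z (g3_bracket x y) = 0" for x y z
  proof -
    have "g3_bracket y (g3_bracket z x) = - g3_bracket y (g3_bracket x z)"
      by (subst g3_bracket_antisym[of z x]) (simp only: g3_bracket_simps)
    moreover have "g3_bracket z (g3_bracket x y) = - g3_bracket (g3_bracket x y) z"
      by (rule g3_bracket_antisym)
    ultimately show ?thesis by (simp add: *[of x y z])
  qed
qed (simp_all add: g3_bracket_simps)

section \<open>Linear forms on maps\<close>

definition fval :: "form \<Rightarrow> (g3 \<Rightarrow> g3) \<Rightarrow> F3" where
  "fval w \<delta> = (\<Sum>((i, k), c)\<leftarrow>w. c * co (\<delta> (bv i)) k)"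

lemma fval_simps [simp]:
  "fval [] \<delta> = 0" "fval (((i, k), c) # w) \<delta> = c * co (\<delta> (bv i)) k + fval w \<delta>"
  "fval (u @ w) \<delta> = fval u \<delta> + fval w \<delta>"
  by (simp_all add: fval_def)

lemma fval_smult [simp]: "fval (smult c w) \<delta> = c * fval w \<delta>"
  by (induction w) (auto simp: smult_def algebra_simps)

lemma linear_fval: "Vector_Spaces.linear (map_scale (*s)) (*) (fval w)"
proof -
  have "fval w (f + g) = fval w f + fval w g" "fval w (map_scale (*s) c f) = c * fval w f" for f g c
    by (induction w) (auto simp: map_scale_def algebra_simps)
  then show ?thesis
    by (simp add: Vector_Spaces.linear_iff vec.vector_space_map_scale
        vector_space_over_itself.vector_space_axioms)
qed

lemma fval_form_value:
  assumes "valid_form w" "\<And>i. i \<in> {1..15} \<Longrightarrow> \<delta> (bv i) = sv (t i) \<and> valid (t i)"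
  shows "fval w \<delta> = form_value w t"
  using assms(1)
  by (induction w) (auto simp: valid_form_def form_value_def assms(2) co_sv)

lemma co_bracket_bv:
  assumes "j \<in> {1..15}" "l \<in> {1..15}"
  shows "co (g3_bracket x (bv j)) l = (\<Sum>k=1..15. co x k * coef (struct k j) l)"
    and "co (g3_bracket (bv j) x) l = (\<Sum>k=1..15. co x k * coef (struct j k) l)"
proof -
  have x: "x = (\<Sum>k=1..15. co x k *s bv k)"
    by (rule g3_eqI) (simp add: co_bv if_distrib cong: if_cong)
  have "g3_bracket x (bv j) = (\<Sum>k=1..15. co x k *s g3_bracket (bv k) (bv j))"
    by (subst x) (simp only: vec.linear_sum[OF g3_bracket_linear(1)] g3_bracket_simps)
  also have "\<dots> = (\<Sum>k=1..15. co x k *s sv (struct k j))"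
    using assms(1) by (intro sum.cong refl) (simp only: g3_bracket_struct)
  finally show "co (g3_bracket x (bv j)) l = (\<Sum>k=1..15. co x k * coef (struct k j) l)"
    using assms(2) by (simp only: co_simps co_sv[OF valid_struct])
  have "g3_bracket (bv j) x = (\<Sum>k=1..15. co x k *s g3_bracket (bv j) (bv k))"
    by (subst x) (simp only: vec.linear_sum[OF g3_bracket_linear(2)] g3_bracket_simps)
  also have "\<dots> = (\<Sum>k=1..15. co x k *s sv (struct j k))"
    using assms(1) by (intro sum.cong refl) (simp only: g3_bracket_struct)
  finally show "co (g3_bracket (bv j) x) l = (\<Sum>k=1..15. co x k * coef (struct j k) l)"
    using assms(2) by (simp only: co_simps co_sv[OF valid_struct])
qed

lemma fval_derivation_form:
  assumes "\<delta> \<in> Der (*s) g3_bracket"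
  shows "fval (derivation_form i j l) \<delta> = 0"
proof (cases "i \<in> {1..15} \<and> j \<in> {1..15} \<and> l \<in> {1..15}")
  case True
  have lin: "Vector_Spaces.linear (*s) (*s) \<delta>" and
    der: "\<delta> (g3_bracket a b) = g3_bracket (\<delta> a) b + g3_bracket a (\<delta> b)" for a b
    using assms by (auto simp: Der_def)
  have 1: "fval (map (\<lambda>(k, c). ((k, l), c)) u) \<delta> = co (\<delta> (sv u)) l" for u
    by (induction u) (auto simp: g3_linearD[OF lin])
  have 2: "fval (filter (\<lambda>(_, c). c \<noteq> 0) w) \<delta> = fval w \<delta>" for w
    by (induction w) auto
  have 3: "fval (concat (map (\<lambda>k. [((i, k), 2 * f k), ((j, k), 2 * g k)]) ks)) \<delta>
      = 2 * ((\<Sum>k\<leftarrow>ks. co (\<delta> (bv i)) k * f k) + (\<Sum>k\<leftarrow>ks. co (\<delta> (bv j)) k * g k))" for f g ks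
    by (induction ks) (simp_all add: algebra_simps)
  have "fval (derivation_form i j l) \<delta> = co (\<delta> (g3_bracket (bv i) (bv j))) l
      + 2 * ((\<Sum>k\<leftarrow>[1..<16]. co (\<delta> (bv i)) k * coef (struct k j) l)
        + (\<Sum>k\<leftarrow>[1..<16]. co (\<delta> (bv j)) k * coef (struct i k) l))"
    using True by (simp add: derivation_form_def 1 2 3 g3_bracket_struct del: upt_rec_numeral)
  also have "\<dots> = co (\<delta> (g3_bracket (bv i) (bv j))) l
      - co (g3_bracket (\<delta> (bv i)) (bv j) + g3_bracket (bv i) (\<delta> (bv j))) l"
  proof -
    have "{1..<16} = {1..15::nat}" by auto
    then show ?thesis
      using True by (simp add: sum_list_distinct_conv_sum_set co_bracket_bv del: upt_rec_numeral flip: minus_eq_2)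
  qed
  finally show ?thesis by (simp add: der)
qed (auto simp: derivation_form_def)

text \<open>A combination of vanishing forms vanishes, and entries in \<open>K\<close> contribute
  nothing to it. A successful step leaves a non-zero multiple of the entry \<open>x\<close>; a
  failing step stops with the \<open>K\<close> reached so far.\<close>

lemma propagate_sound:
  assumes "\<And>i j l. fval (derivation_form i j l) \<delta> = 0" "\<And>w. w \<in> set ws \<Longrightarrow> fval w \<delta> = 0"
    and "\<forall>(i, k)\<in>set K. co (\<delta> (bv i)) k = 0"
  shows "\<forall>(i, k)\<in>set (propagate ws K steps). co (\<delta> (bv i)) k = 0"
  using assms(3)
proof (induction steps arbitrary: K)
  case (Cons p steps)
  obtain x es where p: "p = (x, es)" by (cases p)
  define val where "val = (\<lambda>(i, k). co (\<delta> (bv i)) k)"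
  have fval_val: "fval w \<delta> = (\<Sum>(y, c)\<leftarrow>w. c * val y)" for w
    by (induction w) (auto simp: val_def)
  define w0 where "w0 = concat (map (\<lambda>(e, c). smult c (eqn_form ws e)) es)"
  define w where "w = filter (\<lambda>(y, _). y \<notin> set K) w0"
  have "fval (eqn_form ws e) \<delta> = 0" for e
    using assms(1,2) by (cases e) auto
  then have "fval w0 \<delta> = 0"
    unfolding w0_def by (induction es) auto
  moreover have "fval w \<delta> = fval w0 \<delta>"
    unfolding w_def fval_val using Cons.prems by (induction w0) (auto simp: val_def)
  \<comment> \<open>Repeated entries are merged here; \<open>insert x\<close> puts \<open>x\<close>
    among the summation indices in every case.\<close>
  ultimately have w: "(\<Sum>y\<in>insert x (fst ` set w). coef w y * val y) = 0"
    unfolding fval_val by (subst (asm) (1) vector_space_over_itself.sparse_sum) auto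
  show ?case
  proof (cases "coef w x \<noteq> 0 \<and> list_all (\<lambda>(y, _). y = x \<or> coef w y = 0) w")
    case True
    then have "(\<Sum>y\<in>insert x (fst ` set w). coef w y * val y)
        = (\<Sum>y\<in>insert x (fst ` set w). if y = x then coef w x * val x else 0)"
      by (intro sum.cong) (auto simp: list_all_iff)
    then have "val x = 0" using w True by simp
    then have "\<forall>(i, k)\<in>set (x # K). co (\<delta> (bv i)) k = 0"
      using Cons.prems by (auto simp: val_def)
    then have "\<forall>(i, k)\<in>set (propagate ws (x # K) steps). co (\<delta> (bv i)) k = 0"
      by (rule Cons.IH)
    then show ?thesis using True by (simp add: p Let_def flip: w0_def w_def)
  next
    case False
    then have "propagate ws K (p # steps) = K" by (auto simp: p Let_def simp flip: w0_def w_def)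
    then show ?thesis using Cons.prems by (simp only:)
  qed
qed simp

lemma two_neq_0: "2 \<noteq> (0 :: F3)"
  by code_simp

text \<open>These brackets produce v_7, ..., v_15 successively from v_1, ..., v_6.\<close>

lemma struct_values:
  "struct 1 2 = [(7, 2)]" "struct 1 3 = [(7, 1), (8, 2)]" "struct 2 3 = [(8, 2), (9, 1)]"
  "struct 1 4 = [(10, 2)]" "struct 1 5 = [(11, 1)]" "struct 1 6 = [(12, 1)]"
  "struct 4 7 = [(13, 1)]" "struct 4 8 = [(15, 2)]" "struct 4 9 = [(14, 1), (15, 1)]"
  by code_simp+

text \<open>The certificate shows that \<delta> kills v_1, ..., v_6. The kernel of a derivation is
  closed under brackets, so it contains the remaining basis vectors too.\<close>

lemma Der_eq_0:
  assumes der: "\<delta> \<in> Der (*s) g3_bracket"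
    and "\<And>w M. (w, M) \<in> set all_families \<Longrightarrow> fval w \<delta> = 0"
  shows "\<delta> = 0"
proof -
  define K where "K = propagate (map fst all_families) [] certificate"
  have lin: "Vector_Spaces.linear (*s) (*s) \<delta>" using der by (simp add: Der_def)
  have "\<forall>(i, k)\<in>set K. co (\<delta> (bv i)) k = 0"
    unfolding K_def using assms(2) fval_derivation_form[OF der] by (intro propagate_sound) auto
  then have gen: "\<delta> (bv i) = 0" if "i \<in> {1..6}" for i
    using that certificate_check[folded K_def, unfolded Let_def list_all_iff set_upt]
    by (intro g3_eqI) auto
  have struct: "\<delta> (sv (struct i j)) = 0"
    if "\<delta> (bv i) = 0" "\<delta> (bv j) = 0" "i \<in> {1..15}" "j \<in> {1..15}" for i j
    using der that by (simp add: Der_def g3_bracket_simps flip: g3_bracket_struct)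
  have 2: "2 *s x = 0 \<Longrightarrow> x = 0" for x :: g3
    using two_neq_0 by (simp only: vec.scale_eq_0_iff) simp
  note simps = g3_linearD[OF lin]
  have *: "\<delta> (bv 7) = 0" "\<delta> (bv 10) = 0" "\<delta> (bv 11) = 0" "\<delta> (bv 12) = 0"
    using struct[of 1 2, unfolded struct_values] struct[of 1 4, unfolded struct_values]
      struct[of 1 5, unfolded struct_values] struct[of 1 6, unfolded struct_values]
    by (simp_all add: gen simps 2)
  have 8: "\<delta> (bv 8) = 0" using struct[of 1 3, unfolded struct_values] by (simp add: gen simps 2 *)
  have 9: "\<delta> (bv 9) = 0" using struct[of 2 3, unfolded struct_values] by (simp add: gen simps 2 8)
  have **: "\<delta> (bv 13) = 0" "\<delta> (bv 15) = 0"
    using struct[of 4 7, unfolded struct_values] struct[of 4 8, unfolded struct_values] by (simp_all add: gen simps 2 * 8)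
  have 14: "\<delta> (bv 14) = 0" using struct[of 4 9, unfolded struct_values] by (simp add: gen simps 9 **)
  have "\<delta> = (\<lambda>x. 0)"
  proof (rule g3_linear_eqI[OF lin])
    fix i :: nat assume "i \<in> {1..15}"
    then have "i \<in> {1..6} \<or> i = 7 \<or> i = 8 \<or> i = 9 \<or> i = 10 \<or> i = 11 \<or> i = 12 \<or> i = 13 \<or> i = 14 \<or> i = 15"
      by auto
    then show "\<delta> (bv i) = 0" using gen * 8 9 ** 14 by blast
  qed (simp add: g3_linearI)
  then show ?thesis by (simp add: fun_eq_iff)
qed

section \<open>Almost-inner derivations\<close>

text \<open>The non-zero structure constants with output coordinate \<open>l\<close>, listed so that
  coordinates of brackets expand into explicit polynomials.\<close>

definition bilinear_form :: "nat \<Rightarrow> form" where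
  "bilinear_form l = filter (\<lambda>(_, c). c \<noteq> 0)
     (concat (map (\<lambda>i. map (\<lambda>j. ((i, j), coef (struct i j) l)) [1..<16]) [1..<16]))"

lemma co_g3_bracket:
  assumes "l \<in> {1..15}"
  shows "co (g3_bracket x y) l = (\<Sum>((i, j), c)\<leftarrow>bilinear_form l. c * (co x i * co y j))"
proof -
  have 1: "(\<Sum>((i, j), c)\<leftarrow>filter (\<lambda>(_, c). c \<noteq> 0) w. c * (co x i * co y j))
      = (\<Sum>((i, j), c)\<leftarrow>w. c * (co x i * co y j))" for w
    by (induction w) auto
  have 2: "(\<Sum>((i, j), c)\<leftarrow>concat (map (\<lambda>i. map (\<lambda>j. ((i, j), f i j)) js) ks). c * (co x i * co y j))
      = (\<Sum>i\<leftarrow>ks. \<Sum>j\<leftarrow>js. f i j * (co x i * co y j))" for f js ks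
    by (induction ks) (simp_all add: comp_def)
  have "{1..<16} = {1..15::nat}" by auto
  then have "(\<Sum>((i, j), c)\<leftarrow>bilinear_form l. c * (co x i * co y j))
      = (\<Sum>i=1..15. \<Sum>j=1..15. coef (struct i j) l * (co x i * co y j))"
    unfolding bilinear_form_def 1 2 by (simp add: sum_list_distinct_conv_sum_set del: upt_rec_numeral)
  then show ?thesis
    by (simp add: g3_bracket_co g3_structure_eq co_sv[OF valid_struct assms] mult.commute)
qed

lemma bilinear_form_values:
  "bilinear_form 10 =
     [((1,4),2), ((2,5),2), ((3,6),2), ((4,1),1), ((5,2),1), ((6,3),1)]"
  "bilinear_form 11 =
     [((1,5),1), ((2,6),1), ((3,4),2), ((3,5),1), ((4,3),1), ((5,1),2), ((5,3),2), ((6,2),2)]"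
  "bilinear_form 12 =
     [((1,6),1), ((2,4),2), ((2,5),1), ((3,5),2), ((3,6),1), ((4,2),1), ((5,2),2), ((5,3),1),
     ((6,1),2), ((6,3),2)]"
  "bilinear_form 13 =
     [((1,10),2), ((2,10),1), ((2,11),1), ((3,10),2), ((3,11),1), ((3,12),1), ((4,7),1),
     ((5,8),2), ((6,9),2), ((7,4),2), ((8,5),1), ((9,6),1), ((10,1),1), ((10,2),2),
     ((10,3),1), ((11,2),2), ((11,3),2), ((12,3),2)]"
  "bilinear_form 14 =
     [((1,11),1), ((2,11),2), ((2,12),1), ((3,10),1), ((3,11),2), ((3,12),1), ((4,9),1),
     ((5,7),1), ((5,9),2), ((6,8),2), ((7,5),2), ((8,6),1), ((9,4),2), ((9,5),1), ((10,3),2),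
     ((11,1),2), ((11,2),1), ((11,3),1), ((12,2),2), ((12,3),2)]"
  "bilinear_form 15 =
     [((1,11),1), ((1,12),2), ((2,10),2), ((2,11),1), ((2,12),2), ((3,11),2), ((3,12),2),
     ((4,8),2), ((4,9),1), ((5,7),1), ((5,8),1), ((5,9),1), ((6,7),2), ((6,8),2), ((6,9),1),
     ((7,5),2), ((7,6),1), ((8,4),1), ((8,5),2), ((8,6),1), ((9,4),2), ((9,5),2), ((9,6),2),
     ((10,2),1), ((11,1),2), ((11,2),2), ((11,3),1), ((12,1),1), ((12,2),1), ((12,3),1)]"
  by code_simp+

text \<open>In the grading, only brackets of A with A reach a degree below D, namely C.\<close>

lemma bilinear_form_low:
  "list_all (\<lambda>l. list_all (\<lambda>((i, j), _). 1 \<le> i \<and> i \<le> 3 \<and> 1 \<le> j \<and> j \<le> 3) (bilinear_form l)) [1..<10]"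
  by code_simp

lemma co_g3_bracket_low:
  assumes "l \<in> {1..9}" and x: "co x 1 = 0" "co x 2 = 0" "co x 3 = 0"
  shows "co (g3_bracket v x) l = 0"
proof -
  have "co x j = 0" if "((i, j), c) \<in> set (bilinear_form l)" for i j c
  proof -
    have "1 \<le> j \<and> j \<le> 3"
      using bilinear_form_low[unfolded list_all_iff set_upt, rule_format, of l "((i, j), c)"]
        assms(1) that by simp
    then have "j = 1 \<or> j = 2 \<or> j = 3" by linarith
    then show ?thesis using x by metis
  qed
  then have "\<forall>((i, j), c)\<in>set (bilinear_form l). c * (co v i * co x j) = 0"
    by auto
  moreover have "(\<Sum>((i, j), c)\<leftarrow>w. c * (co v i * co x j)) = 0"
    if "\<forall>((i, j), c)\<in>set w. c * (co v i * co x j) = 0" for w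
    using that by (induction w) auto
  ultimately have "(\<Sum>((i, j), c)\<leftarrow>bilinear_form l. c * (co v i * co x j)) = 0"
    by blast
  then show ?thesis using assms(1) by (simp add: co_g3_bracket)
qed

text \<open>This and the next two functions are the components A \<times> B \<rightarrow> D, A
  \<times> D \<rightarrow> Z and B \<times> C \<rightarrow> Z of the bracket, in the coordinates of
  the triples of basis vectors.\<close>

fun mult_AB :: "F3 \<times> F3 \<times> F3 \<Rightarrow> F3 \<times> F3 \<times> F3 \<Rightarrow> F3 \<times> F3 \<times> F3" where
  "mult_AB (x1, x2, x3) (y1, y2, y3) =
   (2 * x1 * y1 + 2 * x2 * y2 + 2 * x3 * y3,
    x1 * y2 + x2 * y3 + 2 * x3 * y1 + x3 * y2,
    x1 * y3 + 2 * x2 * y1 + x2 * y2 + 2 * x3 * y2 + x3 * y3)"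

fun mult_AD :: "F3 \<times> F3 \<times> F3 \<Rightarrow> F3 \<times> F3 \<times> F3 \<Rightarrow> F3 \<times> F3 \<times> F3" where
  "mult_AD (x1, x2, x3) (y1, y2, y3) =
   (2 * x1 * y1 + x2 * y1 + x2 * y2 + 2 * x3 * y1 + x3 * y2 + x3 * y3,
    x1 * y2 + 2 * x2 * y2 + x2 * y3 + x3 * y1 + 2 * x3 * y2 + x3 * y3,
    x1 * y2 + 2 * x1 * y3 + 2 * x2 * y1 + x2 * y2 + 2 * x2 * y3 + 2 * x3 * y2 + 2 * x3 * y3)"

fun mult_BC :: "F3 \<times> F3 \<times> F3 \<Rightarrow> F3 \<times> F3 \<times> F3 \<Rightarrow> F3 \<times> F3 \<times> F3" where
  "mult_BC (x1, x2, x3) (y1, y2, y3) =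
   (x1 * y1 + 2 * x2 * y2 + 2 * x3 * y3,
    x1 * y3 + x2 * y1 + 2 * x2 * y3 + 2 * x3 * y2,
    2 * x1 * y2 + x1 * y3 + x2 * y1 + x2 * y2 + x2 * y3 + 2 * x3 * y1 + 2 * x3 * y2 + x3 * y3)"

text \<open>Each statement is a check of the 27 * 27 pairs of triples.\<close>

lemma no_zero_divisors:
  "\<forall>x y. mult_AB x y = (0, 0, 0) \<longrightarrow> x = (0, 0, 0) \<or> y = (0, 0, 0)"
  "\<forall>x y. mult_AD x y = (0, 0, 0) \<longrightarrow> x = (0, 0, 0) \<or> y = (0, 0, 0)"
  "\<forall>x y. mult_BC x y = (0, 0, 0) \<longrightarrow> x = (0, 0, 0) \<or> y = (0, 0, 0)"
  by code_simp+

lemma mult_diff: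
  "mult_AB x (y - z) = mult_AB x y - mult_AB x z" "mult_AB (y - z) x = mult_AB y x - mult_AB z x"
  "mult_AD x (y - z) = mult_AD x y - mult_AD x z" "mult_AD (y - z) x = mult_AD y x - mult_AD z x"
  "mult_BC x (y - z) = mult_BC x y - mult_BC x z" "mult_BC (y - z) x = mult_BC y x - mult_BC z x"
  by (cases x; cases y; cases z; simp add: algebra_simps)+

text \<open>An additive map with trivial kernel is injective, and on a finite set an injective
  self-map is surjective.\<close>

lemma triple_surj:
  fixes f :: "F3 \<times> F3 \<times> F3 \<Rightarrow> F3 \<times> F3 \<times> F3"
  assumes "\<And>y z. f (y - z) = f y - f z" "\<And>y. f y = (0, 0, 0) \<Longrightarrow> y = (0, 0, 0)"
  shows "\<exists>y1 y2 y3. f (y1, y2, y3) = t"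
proof -
  have "inj f"
  proof (rule injI)
    fix y z assume "f y = f z"
    then have "f (y - z) = (0, 0, 0)" by (simp add: assms(1) zero_prod_def)
    then have "y - z = 0" using assms(2) by (simp add: zero_prod_def)
    then show "y = z" by simp
  qed
  then have "surj f" by (intro finite_UNIV_inj_surj) auto
  then obtain y where "f y = t" by (metis surjD)
  then show ?thesis by (cases y) auto
qed

lemma mult_surj:
  assumes "x \<noteq> (0, 0, 0)"
  shows "\<exists>y1 y2 y3. mult_AB x (y1, y2, y3) = t" "\<exists>y1 y2 y3. mult_AB (y1, y2, y3) x = t"
    "\<exists>y1 y2 y3. mult_AD x (y1, y2, y3) = t" "\<exists>y1 y2 y3. mult_AD (y1, y2, y3) x = t"
    "\<exists>y1 y2 y3. mult_BC x (y1, y2, y3) = t" "\<exists>y1 y2 y3. mult_BC (y1, y2, y3) x = t"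
proof -
  show "\<exists>y1 y2 y3. mult_AB x (y1, y2, y3) = t"
    using no_zero_divisors(1)[rule_format, of x] assms by (intro triple_surj mult_diff(1)) blast
  show "\<exists>y1 y2 y3. mult_AB (y1, y2, y3) x = t"
    using no_zero_divisors(1)[rule_format, of _ x] assms
    by (intro triple_surj[of "\<lambda>y. mult_AB y x"] mult_diff(2)) blast
  show "\<exists>y1 y2 y3. mult_AD x (y1, y2, y3) = t"
    using no_zero_divisors(2)[rule_format, of x] assms by (intro triple_surj mult_diff(3)) blast
  show "\<exists>y1 y2 y3. mult_AD (y1, y2, y3) x = t"
    using no_zero_divisors(2)[rule_format, of _ x] assms
    by (intro triple_surj[of "\<lambda>y. mult_AD y x"] mult_diff(4)) blast
  show "\<exists>y1 y2 y3. mult_BC x (y1, y2, y3) = t"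
    using no_zero_divisors(3)[rule_format, of x] assms by (intro triple_surj mult_diff(5)) blast
  show "\<exists>y1 y2 y3. mult_BC (y1, y2, y3) x = t"
    using no_zero_divisors(3)[rule_format, of _ x] assms
    by (intro triple_surj[of "\<lambda>y. mult_BC y x"] mult_diff(6)) blast
qed

section \<open>Solving w = [x, v] for given v and w\<close>

definition triple :: "g3 \<Rightarrow> nat \<Rightarrow> F3 \<times> F3 \<times> F3" where
  "triple x p = (co x p, co x (p + 1), co x (p + 2))"

lemma triple_simps [simp]:
  "triple (x + y) p = triple x p + triple y p" "triple (x - y) p = triple x p - triple y p"
  "triple (- x) p = - triple x p"
  by (simp_all add: triple_def)

lemma triple_eq_0:
  assumes "triple x p = 0" "p \<le> i" "i \<le> p + 2"
  shows "co x i = 0"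
proof -
  have "i = p \<or> i = p + 1 \<or> i = p + 2" using assms(2,3) by linarith
  then show ?thesis using assms(1) by (auto simp: triple_def zero_prod_def)
qed

lemma g3_eqI_triple:
  assumes "\<And>l. l \<in> {1..9} \<Longrightarrow> co x l = co y l" "triple x 10 = triple y 10" "triple x 13 = triple y 13"
  shows "x = y"
proof (rule g3_eqI)
  fix l :: nat assume "l \<in> {1..15}"
  then have "l \<in> {1..9} \<or> l = 10 \<or> l = 11 \<or> l = 12 \<or> l = 13 \<or> l = 14 \<or> l = 15" by auto
  then show "co x l = co y l" using assms by (auto simp: triple_def)
qed

text \<open>Bracketing with an element of a single degree isolates one graded component of
  \<open>v\<close> in each of the degrees D and Z.\<close>

lemma triple_bracket:
  "triple (g3_bracket v (sv [(4, y1), (5, y2), (6, y3)])) 10 = mult_AB (triple v 1) (y1, y2, y3)"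
  "triple (g3_bracket (sv [(1, y1), (2, y2), (3, y3)]) v) 10 = mult_AB (y1, y2, y3) (triple v 4)"
  "triple (g3_bracket v (sv [(10, y1), (11, y2), (12, y3)])) 13 = mult_AD (triple v 1) (y1, y2, y3)"
  "triple (g3_bracket (sv [(1, y1), (2, y2), (3, y3)]) v) 13 = mult_AD (y1, y2, y3) (triple v 10)"
  "triple (g3_bracket v (sv [(7, y1), (8, y2), (9, y3)])) 13 = mult_BC (triple v 4) (y1, y2, y3)"
  "triple (g3_bracket (sv [(4, y1), (5, y2), (6, y3)]) v) 13 = mult_BC (y1, y2, y3) (triple v 7)"
  "triple (g3_bracket v (sv [(10, y1), (11, y2), (12, y3)])) 10 = 0"
  "triple (g3_bracket v (sv [(7, y1), (8, y2), (9, y3)])) 10 = 0"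
  by (simp_all add: triple_def co_g3_bracket bilinear_form_values co_sv zero_prod_def ac_simps
      del: sv_simps One_nat_def)


text \<open>According to the first non-zero component of \<open>v\<close> in the order A, B, D, C,
  bracket \<open>v\<close> with elements of D, C, A, B respectively. These brackets lie in Z, and
  \<open>mult_surj\<close> makes them fill Z.\<close>

lemma ex_bracket_13:
  assumes "triple v 1 \<noteq> 0 \<or> triple v 4 \<noteq> 0 \<or> triple v 7 \<noteq> 0 \<or> triple v 10 \<noteq> 0"
    and "\<And>l. l \<in> {1..9} \<Longrightarrow> co w l = 0" "triple w 10 = 0"
  shows "\<exists>x. w = g3_bracket x v"
proof -
  have "(triple v 1 \<noteq> 0) \<or> (triple v 1 = 0 \<and> triple v 4 \<noteq> 0)
      \<or> (triple v 1 = 0 \<and> triple v 4 = 0 \<and> triple v 10 \<noteq> 0)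
      \<or> (triple v 1 = 0 \<and> triple v 4 = 0 \<and> triple v 10 = 0 \<and> triple v 7 \<noteq> 0)"
    using assms(1) by blast
  then consider (A) "triple v 1 \<noteq> 0" | (B) "triple v 1 = 0" "triple v 4 \<noteq> 0"
    | (D) "triple v 1 = 0" "triple v 4 = 0" "triple v 10 \<noteq> 0"
    | (C) "triple v 1 = 0" "triple v 4 = 0" "triple v 10 = 0" "triple v 7 \<noteq> 0"
    by blast
  then show ?thesis
  proof cases
    case A
    then obtain y1 y2 y3 where y: "mult_AD (triple v 1) (y1, y2, y3) = - triple w 13"
      using mult_surj(3)[of "triple v 1" "- triple w 13"] by (auto simp: zero_prod_def)
    let ?y = "sv [(10, y1), (11, y2), (12, y3)]"
    have "w = - g3_bracket v ?y"
      by (rule g3_eqI_triple)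
        (simp_all add: triple_bracket y assms co_g3_bracket_low co_sv del: sv_simps One_nat_def)
    then show ?thesis by (metis g3_bracket_antisym)
  next
    case B
    then obtain y1 y2 y3 where y: "mult_BC (triple v 4) (y1, y2, y3) = - triple w 13"
      using mult_surj(5)[of "triple v 4" "- triple w 13"] by (auto simp: zero_prod_def)
    let ?y = "sv [(7, y1), (8, y2), (9, y3)]"
    have "w = - g3_bracket v ?y"
      by (rule g3_eqI_triple)
        (simp_all add: triple_bracket y assms co_g3_bracket_low co_sv del: sv_simps One_nat_def)
    then show ?thesis by (metis g3_bracket_antisym)
  next
    case D
    then obtain y1 y2 y3 where y: "mult_AD (y1, y2, y3) (triple v 10) = triple w 13"
      using mult_surj(4)[of "triple v 10" "triple w 13"] by (auto simp: zero_prod_def)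
    let ?y = "sv [(1, y1), (2, y2), (3, y3)]"
    \<comment> \<open>Since \<open>v\<close> has no component in B, its bracket with an element of A
      has none in D.\<close>
    have "mult_AB (y1, y2, y3) 0 = 0" by (simp add: zero_prod_def)
    then have "w = g3_bracket ?y v"
      using triple_eq_0[OF D(1)] D
      by (intro g3_eqI_triple) (simp_all add: triple_bracket y assms co_g3_bracket_low del: sv_simps One_nat_def)
    then show ?thesis by blast
  next
    case C
    then obtain y1 y2 y3 where y: "mult_BC (y1, y2, y3) (triple v 7) = triple w 13"
      using mult_surj(6)[of "triple v 7" "triple w 13"] by (auto simp: zero_prod_def)
    let ?y = "sv [(4, y1), (5, y2), (6, y3)]"
    \<comment> \<open>Likewise, \<open>v\<close> has no component in A, so its bracket with an
      element of B has none in D.\<close>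
    have "mult_AB (triple v 1) (y1, y2, y3) = 0" using C by (simp add: zero_prod_def)
    then have "triple (g3_bracket ?y v) 10 = 0"
      by (subst g3_bracket_antisym) (simp add: triple_bracket del: sv_simps One_nat_def)
    then have "w = g3_bracket ?y v"
      using triple_eq_0[OF C(1)] C
      by (intro g3_eqI_triple) (simp_all add: triple_bracket y assms co_g3_bracket_low del: sv_simps One_nat_def)
    then show ?thesis by blast
  qed
qed

text \<open>The D-component of \<open>w\<close> is matched first, by a bracket with an element of B
  if \<open>v\<close> has a component in A, and of A otherwise. Neither choice creates a component
  in C.\<close>

lemma ex_bracket_10:
  assumes "triple v 1 \<noteq> 0 \<or> triple v 4 \<noteq> 0" "\<And>l. l \<in> {1..9} \<Longrightarrow> co w l = 0"
  shows "\<exists>x. w = g3_bracket x v"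
proof -
  have "\<exists>y. (\<forall>l\<in>{1..9}. co (g3_bracket y v) l = 0) \<and> triple (g3_bracket y v) 10 = triple w 10"
  proof (cases "triple v 1 = 0")
    case False
    then obtain y1 y2 y3 where y: "mult_AB (triple v 1) (y1, y2, y3) = - triple w 10"
      using mult_surj(1)[of "triple v 1" "- triple w 10"] by (auto simp: zero_prod_def)
    let ?y = "sv [(4, y1), (5, y2), (6, y3)]"
    have "co (g3_bracket ?y v) l = 0" if "l \<in> {1..9}" for l
      using that by (subst g3_bracket_antisym) (simp add: co_g3_bracket_low co_sv del: sv_simps One_nat_def)
    moreover have "triple (g3_bracket ?y v) 10 = triple w 10"
      by (subst g3_bracket_antisym) (simp add: triple_bracket y del: sv_simps One_nat_def)
    ultimately show ?thesis by blast
  next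
    case True
    then obtain y1 y2 y3 where y: "mult_AB (y1, y2, y3) (triple v 4) = triple w 10"
      using assms(1) mult_surj(2)[of "triple v 4" "triple w 10"] by (auto simp: zero_prod_def)
    let ?y = "sv [(1, y1), (2, y2), (3, y3)]"
    have "co (g3_bracket ?y v) l = 0" if "l \<in> {1..9}" for l
      using that True by (simp add: co_g3_bracket_low triple_def zero_prod_def del: sv_simps One_nat_def)
    moreover have "triple (g3_bracket ?y v) 10 = triple w 10"
      by (simp add: triple_bracket y del: sv_simps One_nat_def)
    ultimately show ?thesis by blast
  qed
  then obtain y where y: "\<forall>l\<in>{1..9}. co (g3_bracket y v) l = 0" "triple (g3_bracket y v) 10 = triple w 10"
    by blast
  \<comment> \<open>The remainder lies in Z and \<open>v\<close> is not central.\<close>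
  have "\<exists>x. w - g3_bracket y v = g3_bracket x v"
    by (rule ex_bracket_13) (use assms y in auto)
  then obtain x where "w - g3_bracket y v = g3_bracket x v" by blast
  then have "w = g3_bracket (x + y) v" by (simp add: g3_bracket_simps algebra_simps)
  then show ?thesis by blast
qed

text \<open>The image \<delta> v lies in D \<oplus> Z in general, in Z if v has no component in A
  \<oplus> B, and is 0 if v is in Z; in each case it lies in [\<gg>, v]. The family \<open>t\<close>
  only describes \<delta> on the basis, so that sums such as a listed map plus an inner derivation
  are covered.\<close>

lemma AID_of_central_type:
  assumes der: "\<delta> \<in> Der (*s) g3_bracket" and "central_type t"
    and t: "\<And>i. i \<in> {1..15} \<Longrightarrow> \<delta> (bv i) = sv (t i) \<and> valid (t i)"
  shows "\<delta> \<in> AID (*s) g3_bracket"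
proof -
  have lin: "Vector_Spaces.linear (*s) (*s) \<delta>" using der by (simp add: Der_def)
  have *: "co (\<delta> (bv i)) k = 0"
    if "i \<in> {1..15}" "k \<in> {1..15}" "k < (if i \<le> 6 then 10 else if i \<le> 12 then 13 else 16)" for i k
  proof (cases "k \<in> fst ` set (t i)")
    case True
    then show ?thesis
      using assms(2)[unfolded central_type_def list_all_iff set_upt] that t[OF that(1)]
      by (fastforce simp: co_sv)
  next
    case False
    then show ?thesis using that t[OF that(1)] by (simp add: co_sv coef_notin)
  qed
  have co_\<delta>: "co (\<delta> v) k = (\<Sum>i=1..15. co v i * co (\<delta> (bv i)) k)" for v k
  proof -
    have v: "v = (\<Sum>i=1..15. co v i *s bv i)"
      by (rule g3_eqI) (simp add: co_bv if_distrib cong: if_cong)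
    show ?thesis by (subst v) (simp only: vec.linear_sum[OF lin] g3_linearD[OF lin] co_simps)
  qed
  have "\<exists>x. \<delta> v = g3_bracket x v" for v
  proof -
    have sum_0: "co (\<delta> v) k = 0"
      if "\<And>i. i \<in> {1..15} \<Longrightarrow> co v i = 0 \<or> co (\<delta> (bv i)) k = 0" for k
      by (subst co_\<delta>, rule sum.neutral) (use that in auto)
    have 9: "co (\<delta> v) k = 0" if "k \<in> {1..9}" for k
      using that by (intro sum_0 disjI2 *) auto
    have 12: "co (\<delta> v) k = 0" if "\<And>i. i \<in> {1..6} \<Longrightarrow> co v i = 0" "k \<in> {1..12}" for k
    proof (rule sum_0)
      show "co v i = 0 \<or> co (\<delta> (bv i)) k = 0" if "i \<in> {1..15}" for i
        using that \<open>k \<in> {1..12}\<close> \<open>\<And>i. i \<in> {1..6} \<Longrightarrow> co v i = 0\<close> *[of i k] by (cases "i \<le> 6") auto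
    qed
    have 15: "\<delta> v = 0" if v: "\<And>i. i \<in> {1..12} \<Longrightarrow> co v i = 0"
    proof (rule g3_eqI)
      fix k :: nat assume k: "k \<in> {1..15}"
      have "co v i = 0 \<or> co (\<delta> (bv i)) k = 0" if "i \<in> {1..15}" for i
        using that k v *[of i k] by (cases "i \<le> 12") auto
      then have "co (\<delta> v) k = 0" by (rule sum_0)
      then show "co (\<delta> v) k = co 0 k" by simp
    qed
    consider "triple v 1 \<noteq> 0 \<or> triple v 4 \<noteq> 0" | "triple v 1 = 0" "triple v 4 = 0"
        "triple v 7 \<noteq> 0 \<or> triple v 10 \<noteq> 0"
      | "triple v 1 = 0" "triple v 4 = 0" "triple v 7 = 0" "triple v 10 = 0"
      by blast
    then show ?thesis
    proof cases
      case 1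
      then show ?thesis using 9 by (rule ex_bracket_10)
    next
      case 2
      then have "co v i = 0" if "i \<in> {1..6}" for i
        using that 2(1,2)[THEN triple_eq_0] by (cases "i \<le> 3") auto
      then have "co (\<delta> v) k = 0" if "k \<in> {1..12}" for k
        using 12 that by blast
      then show ?thesis
        using 2(3) 9 by (intro ex_bracket_13) (auto simp: triple_def zero_prod_def)
    next
      case 3
      then have "co v i = 0" if "i \<in> {1..12}" for i
        using that 3[THEN triple_eq_0]
        by (cases "i \<le> 3"; cases "i \<le> 6"; cases "i \<le> 9") auto
      then have "\<delta> v = g3_bracket 0 v" by (simp only: 15 g3_bracket_simps)
      then show ?thesis ..
    qed
  qed
  then show ?thesis using der by (auto simp: AID_def)
qed

section \<open>Dimensions of \<open>Der\<close> and \<open>Inn\<close>\<close>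

interpretation L: lie_algebra "(*s)" g3_bracket
  by (rule lie_algebra_g3)

interpretation M: vector_space "map_scale ((*s) :: F3 \<Rightarrow> g3 \<Rightarrow> g3)"
  by (rule vec.vector_space_map_scale)

definition family :: "(form \<times> smap) list \<Rightarrow> (((g3 \<Rightarrow> g3) \<Rightarrow> F3) \<times> (g3 \<Rightarrow> g3)) list" where
  "family F = map (\<lambda>(w, M). (fval w, lin M)) F"

lemma family_linear: "p \<in> set (family F) \<Longrightarrow> Vector_Spaces.linear (map_scale (*s)) (*) (fst p)"
  by (auto simp: family_def linear_fval)

lemma inner_indices_range: "list_all (\<lambda>(_, i). 1 \<le> i \<and> i \<le> 12) inner_indices"
  "snd ` set inner_indices = {1..12}"
proof -
  show "list_all (\<lambda>(_, i). 1 \<le> i \<and> i \<le> 12) inner_indices" by (simp add: inner_indices_def)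
  have "snd ` set inner_indices = set [1..<13]" by code_simp
  then show "snd ` set inner_indices = {1..12}" unfolding set_upt by auto
qed

lemma derivation_check_all:
  assumes "(w, M) \<in> set all_families"
  shows "derivation_check M"
proof -
  have "derivation_check M" if "(w, M) \<in> set inner_family"
    using that inner_indices_range(1)[unfolded list_all_iff] sad_check[unfolded list_all_iff set_upt]
    by (fastforce simp: inner_family_def)
  then show ?thesis
    using assms outer_check complement_check by (auto simp: all_families_def list_all_iff)
qed

lemma valid_form_all: "(w, M) \<in> set all_families \<Longrightarrow> valid_form w"
  using valid_forms by (auto simp: list_all_iff)

lemma lin_sparse:
  assumes "derivation_check M" "i \<in> {1..15}"
  shows "lin M (bv i) = sv (lookup M i) \<and> valid (lookup M i)"
  using assms(1) lookup_cases[of M i] lin_bv[OF assms(2)]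
  unfolding derivation_check_def list_all_iff by auto

lemma fval_lin:
  "valid_form w \<Longrightarrow> derivation_check M \<Longrightarrow> fval w (lin M) = form_value w (lookup M)"
  by (intro fval_form_value lin_sparse)

lemma triangular_family:
  assumes "triangular_check F" "set F \<subseteq> set all_families"
  shows "triangular (family F)"
  using assms
proof (induction F)
  case (Cons p F)
  obtain w M where p: "p = (w, M)" by (cases p)
  have eq: "fval w (lin N) = form_value w (lookup N)" if "(w', N) \<in> set (p # F)" for w' N
    using Cons.prems(2) that p
    by (intro fval_lin valid_form_all[of w M] derivation_check_all[of w' N]) auto
  have "fval w (lin M) \<noteq> 0" using eq[of w M] Cons.prems(1) by (simp add: p)
  moreover have "fval w (lin N) = 0" if "(w', N) \<in> set F" for w' N
    using eq[of w' N] Cons.prems(1) that by (auto simp: p list_all_iff)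
  moreover have "triangular (family F)" using Cons by (simp add: p)
  ultimately show ?case by (auto simp: p family_def)
qed (simp add: family_def)

lemma triangular_check_append:
  "triangular_check (F @ G) \<longleftrightarrow> triangular_check F \<and> triangular_check G \<and>
     (\<forall>(w, _)\<in>set F. \<forall>(_, M)\<in>set G. form_value w (lookup M) = 0)"
  by (induction F rule: triangular_check.induct) (auto simp: list_all_iff)

lemma triangular_families:
  "triangular (family all_families)" "triangular (family inner_family)"
  "triangular (family complement_family)"
  using triangular_all unfolding all_families_def triangular_check_append
  by (auto intro!: triangular_family simp: all_families_def triangular_check_append)

text \<open>All listed derivations together form a basis, as their forms separate derivations by
  \<open>Der_eq_0\<close>; 45 = 12 + 12 + 21.\<close>

lemma dim_Der: "M.dim (Der (*s) g3_bracket) = 45"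
proof -
  have "M.dim (Der (*s) g3_bracket) = length (family all_families)"
  proof (rule M.triangular_basis(2))
    show "M.subspace (Der (*s) g3_bracket)"
      using L.lie_subalgebra_Der by (simp add: lie_subalgebra_def)
    show "snd ` set (family all_families) \<subseteq> Der (*s) g3_bracket"
    proof -
      have "lin M \<in> Der (*s) g3_bracket" if "(w, M) \<in> set all_families" for w M
        using that by (intro lin_Der derivation_check_all)
      then show ?thesis by (auto simp: family_def)
    qed
    show "\<delta> = 0" if "\<delta> \<in> Der (*s) g3_bracket" "\<And>p. p \<in> set (family all_families) \<Longrightarrow> fst p \<delta> = 0" for \<delta>
      using that(1)
    proof (rule Der_eq_0)
      show "fval w \<delta> = 0" if "(w, M) \<in> set all_families" for w M
        using that \<open>\<And>p. p \<in> set (family all_families) \<Longrightarrow> fst p \<delta> = 0\<close>[of "(fval w, lin M)"]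
        by (force simp: family_def)
    qed
  qed (auto intro: triangular_families family_linear)
  also have "\<dots> = 45"
    by (simp add: family_def all_families_def outer_family_def inner_family_def inner_indices_def
        complement_family_def)
  finally show ?thesis .
qed

lemma struct_central: "list_all (\<lambda>i. list_all (\<lambda>j. struct i j = []) [1..<16]) [13..<16]"
  by code_simp

lemma inner_family_image: "snd ` set (family inner_family) = (\<lambda>i. lin (sad i)) ` {1..12}"
  unfolding family_def inner_family_def inner_indices_range(2)[symmetric] set_map image_image
  by (simp only: case_prod_unfold fst_conv snd_conv)

lemma sum_apply: "(\<Sum>i\<in>A. f i) y = (\<Sum>i\<in>A. f i y)" for f :: "'i \<Rightarrow> g3 \<Rightarrow> g3"
  by (induction A rule: infinite_finite_induct) auto

text \<open>The map ad is linear and v_13, v_14, v_15 are central, so ad v_1, ..., ad v_12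
  span.\<close>

lemma Inn_eq_span: "M.span (snd ` set (family inner_family)) = Inn g3_bracket"
proof
  have "lin (sad i) \<in> Inn g3_bracket" if "i \<in> {1..12}" for i
    using that by (simp add: lin_sad Inn_def)
  then have "snd ` set (family inner_family) \<subseteq> Inn g3_bracket"
    unfolding inner_family_image by (rule image_subsetI)
  then show "M.span (snd ` set (family inner_family)) \<subseteq> Inn g3_bracket"
    using L.lie_subalgebra_Inn by (intro M.span_minimal) (simp_all add: lie_subalgebra_def)
  have basis: "g3_bracket (bv i) \<in> M.span (snd ` set (family inner_family))" if "i \<in> {1..15}" for i
  proof (cases "i \<le> 12")
    case True
    then have "lin (sad i) \<in> snd ` set (family inner_family)"
      unfolding inner_family_image using that by (intro imageI) simp
    then have "lin (sad i) \<in> M.span (snd ` set (family inner_family))" by (rule M.span_base)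
    then show ?thesis using that by (simp only: lin_sad)
  next
    case False
    have "g3_bracket (bv i) = (\<lambda>x. 0)"
    proof (rule g3_linear_eqI[OF g3_bracket_linear(2)])
      show "g3_bracket (bv i) (bv j) = 0" if "j \<in> {1..15}" for j
        using that \<open>i \<in> {1..15}\<close> False struct_central[unfolded list_all_iff set_upt]
        by (simp add: g3_bracket_struct)
    qed (simp add: g3_linearI)
    then show ?thesis using M.span_zero by (simp add: zero_fun_def)
  qed
  show "Inn g3_bracket \<subseteq> M.span (snd ` set (family inner_family))"
  proof
    fix f assume "f \<in> Inn g3_bracket"
    then obtain x where f: "f = g3_bracket x" by (auto simp: Inn_def)
    have "f = (\<Sum>i=1..15. map_scale (*s) (co x i) (g3_bracket (bv i)))"
    proof
      fix y
      have x: "x = (\<Sum>i=1..15. co x i *s bv i)"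
        by (rule g3_eqI) (simp add: co_bv if_distrib cong: if_cong)
      have "(\<Sum>i=1..15. map_scale (*s) (co x i) (g3_bracket (bv i))) y
          = (\<Sum>i=1..15. co x i *s g3_bracket (bv i) y)"
        by (simp only: sum_apply) (simp add: map_scale_def)
      then show "f y = (\<Sum>i=1..15. map_scale (*s) (co x i) (g3_bracket (bv i))) y"
        unfolding f by (subst x) (simp only: vec.linear_sum[OF g3_bracket_linear(1)] g3_bracket_simps)
    qed
    then show "f \<in> M.span (snd ` set (family inner_family))"
      using basis by (auto intro!: M.span_sum M.span_scale)
  qed
qed

lemma dim_Inn: "M.dim (Inn g3_bracket) = 12"
proof -
  have "M.dim (Inn g3_bracket) = length (family inner_family)"
  proof (rule M.triangular_basis(2))
    show "M.subspace (Inn g3_bracket)"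
      using L.lie_subalgebra_Inn by (simp add: lie_subalgebra_def)
    show "snd ` set (family inner_family) \<subseteq> Inn g3_bracket"
      unfolding Inn_eq_span[symmetric] by (rule M.span_superset)
    show "f = 0" if "f \<in> Inn g3_bracket" "\<And>p. p \<in> set (family inner_family) \<Longrightarrow> fst p f = 0" for f
      using that by (intro M.triangular_span_zero[OF triangular_families(2)])
        (auto simp: Inn_eq_span intro: family_linear)
  qed (auto intro: triangular_families family_linear)
  also have "\<dots> = 12" by (simp add: family_def inner_family_def inner_indices_def)
  finally show ?thesis .
qed

section \<open>The complement of the inner derivations\<close>

text \<open>The form reads only \<delta> v_i for one i, and there \<delta> coincides with some ad x.
  So its value is the one at ad x, and it vanishes on all inner derivations.\<close>

lemma outer_form_AID:
  assumes "\<delta> \<in> AID (*s) g3_bracket" "(w, M) \<in> set outer_family"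
  shows "fval w \<delta> = 0"
proof -
  define i where "i = fst (fst (hd w))"
  have w: "valid_form w" using assms(2) by (intro valid_form_all) (auto simp: all_families_def)
  have row: "i' = i" if "((i', k), c) \<in> set w" for i' k c
    using outer_forms_check assms(2) that by (fastforce simp: list_all_iff i_def)
  obtain x where x: "\<delta> (bv i) = g3_bracket x (bv i)"
    using assms(1) by (auto simp: AID_def image_iff)
  have eq: "fval w \<delta> = fval w (g3_bracket x)"
  proof -
    have "fval u \<delta> = fval u (g3_bracket x)" if "set u \<subseteq> set w" for u
      using that by (induction u) (auto simp: x dest: row)
    then show ?thesis by blast
  qed
  have lin: "Vector_Spaces.linear (map_scale (*s)) (*) (fval w)" by (rule linear_fval)
  have "fval w (g3_bracket x) = 0"
  proof (rule M.functional_zero_on_span[OF lin])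
    show "g3_bracket x \<in> M.span (snd ` set (family inner_family))"
      by (auto simp: Inn_eq_span Inn_def)
    fix f assume "f \<in> snd ` set (family inner_family)"
    then obtain w' N where N: "(w', N) \<in> set inner_family" "f = lin N"
      by (auto simp: family_def)
    have "fval w f = form_value w (lookup N)"
      unfolding N(2) using N(1) by (intro fval_lin w derivation_check_all[of w']) (simp add: all_families_def)
    \<comment> \<open>The outer family precedes the inner one in the triangular list.\<close>
    also have "\<dots> = 0"
      using triangular_all[unfolded all_families_def triangular_check_append] assms(2) N(1) by fastforce
    finally show "fval w f = 0" .
  qed
  then show ?thesis using eq by simp
qed

text \<open>The criterion applies directly except possibly to the first map, for which it applies
  after adding the inner derivation ad v_1.\<close>

lemma complement_AID:
  assumes "(w, M) \<in> set complement_family"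
  shows "lin M \<in> AID (*s) g3_bracket"
proof -
  have check: "derivation_check M"
    using assms by (intro derivation_check_all[of w]) (simp add: all_families_def)
  show ?thesis
  proof (cases "central_type (lookup M)")
    case True
    then show ?thesis
      by (rule AID_of_central_type[OF lin_Der[OF check]]) (rule lin_sparse[OF check])
  next
    case False
    have "complement_family \<noteq> []" by (simp add: complement_family_def)
    then have "(w, M) = hd complement_family \<or> (w, M) \<in> set (tl complement_family)"
      using assms by (metis list.collapse set_ConsD)
    \<comment> \<open>All members of the tail satisfy the criterion by
      \<open>central_type_check\<close>.\<close>
    then have M: "M = snd (hd complement_family)"
      using False central_type_check(2) by (auto simp: list_all_iff) (metis snd_conv)
    have ad1: "g3_bracket (bv 1) \<in> Inn g3_bracket" by (simp add: Inn_def)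
    have sub: "M.subspace (Der (*s) g3_bracket)" "M.subspace (AID (*s) g3_bracket)"
      using L.lie_subalgebra_Der L.lie_subalgebra_AID by (simp_all add: lie_subalgebra_def)
    have "lin M + g3_bracket (bv 1) \<in> AID (*s) g3_bracket"
    proof (rule AID_of_central_type)
      show "lin M + g3_bracket (bv 1) \<in> Der (*s) g3_bracket"
        using L.Inn_subset_AID ad1 check by (intro M.subspace_add[OF sub(1)] lin_Der) (auto simp: AID_def)
      show "central_type (\<lambda>i. lookup M i @ struct 1 i)" unfolding M by (rule central_type_check(1))
      show "(lin M + g3_bracket (bv 1)) (bv i) = sv (lookup M i @ struct 1 i)
          \<and> valid (lookup M i @ struct 1 i)" if "i \<in> {1..15}" for i
        using lin_sparse[OF check that] that by (simp add: g3_bracket_struct valid_struct)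
    qed
    then have "lin M + g3_bracket (bv 1) - g3_bracket (bv 1) \<in> AID (*s) g3_bracket"
      using L.Inn_subset_AID ad1 by (intro M.subspace_diff[OF sub(2)]) auto
    then show ?thesis by simp
  qed
qed

text \<open>Given by equations rather than by a spanning set: membership of an almost-inner
  derivation is then a matter of twelve form values.\<close>

definition complement :: "(g3 \<Rightarrow> g3) set" where
  "complement = {\<delta> \<in> AID (*s) g3_bracket. \<forall>(w, _)\<in>set inner_indices. fval w \<delta> = 0}"

lemma subspace_AID: "M.subspace (AID (*s) g3_bracket)"
  using L.lie_subalgebra_AID by (simp add: lie_subalgebra_def)

lemma subspace_complement: "M.subspace complement"
  using M.linear_functional[OF linear_fval] M.subspace_0[OF subspace_AID]
    M.subspace_add[OF subspace_AID] M.subspace_scale[OF subspace_AID]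
  by (intro M.subspaceI) (fastforce simp: complement_def)+

lemma complement_family_subset: "snd ` set (family complement_family) \<subseteq> complement"
proof -
  have "fval w (lin N) = 0" if "(w, i) \<in> set inner_indices" "(w', N) \<in> set complement_family" for w i w' N
  proof -
    have w: "(w, sad i) \<in> set inner_family" using that(1) by (force simp: inner_family_def)
    have "fval w (lin N) = form_value w (lookup N)"
      using w that(2)
      by (intro fval_lin valid_form_all[of w "sad i"] derivation_check_all[of w'])
        (simp_all add: all_families_def)
    also have "\<dots> = 0"
      using triangular_all[unfolded all_families_def triangular_check_append] w that(2) by fastforce
    finally show ?thesis .
  qed
  then show ?thesis using complement_AID by (fastforce simp: complement_def family_def)
qed

text \<open>Outer forms vanish on almost-inner derivations and inner forms vanish here by
  definition, so by \<open>Der_eq_0\<close> the remaining 21 forms separate the elements.\<close>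

lemma complement_basis:
  "M.span (snd ` set (family complement_family)) = complement" "M.dim complement = 21"
proof -
  have zero: "\<delta> = 0"
    if \<delta>: "\<delta> \<in> complement" "\<And>p. p \<in> set (family complement_family) \<Longrightarrow> fst p \<delta> = 0" for \<delta>
  proof (rule Der_eq_0)
    show "\<delta> \<in> Der (*s) g3_bracket" using \<delta>(1) by (simp add: complement_def AID_def)
    show "fval w \<delta> = 0" if "(w, M) \<in> set all_families" for w M
    proof -
      have "fval w \<delta> = 0" if "(w, M) \<in> set inner_family"
        using that \<delta>(1) by (auto simp: inner_family_def complement_def)
      moreover have "fval w \<delta> = 0" if "(w, M) \<in> set complement_family"
        using \<delta>(2)[of "(fval w, lin M)"] that by (force simp: family_def)
      ultimately show ?thesis
        using that \<delta>(1) outer_form_AID by (auto simp: all_families_def complement_def)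
    qed
  qed
  note basis = M.triangular_basis[OF subspace_complement complement_family_subset
      triangular_families(3) family_linear zero]
  show "M.span (snd ` set (family complement_family)) = complement" by (rule basis(1))
  have "length (family complement_family) = 21" by (simp add: family_def complement_family_def)
  then show "M.dim complement = 21" using basis(2) by simp
qed

lemma sorted_wrt_pairs:
  assumes "sorted_wrt P xs" "x \<in> set xs" "y \<in> set xs"
  shows "x = y \<or> P x y \<or> P y x"
  using assms by (induction xs) auto

lemma fval_commutator_lin:
  assumes "valid_form w" "derivation_check M" "derivation_check N"
  shows "fval w (commutator (lin M) (lin N)) = form_value w (scommutator M N)"
proof (rule fval_form_value[OF assms(1)])
  fix i :: nat assume i: "i \<in> {1..15}"
  have valid: "valid (sapply (lookup K) u)" if "derivation_check K" for K u
  proof -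
    have "valid (lookup K i)" for i
      using that lookup_cases[of K i] unfolding derivation_check_def list_all_iff by auto
    then show ?thesis by (induction u) (auto simp: sapply_def)
  qed
  show "commutator (lin M) (lin N) (bv i) = sv (scommutator M N i) \<and> valid (scommutator M N i)"
    using lin_sparse[OF assms(2) i] lin_sparse[OF assms(3) i] valid assms(2,3)
    by (simp add: commutator_def scommutator_def lin_sv flip: minus_eq_2)
qed

text \<open>Linearity in each argument, for extending \<open>scommutator_check\<close> from the
  basis to the whole complement.\<close>

lemma commutator_functional:
  assumes "Vector_Spaces.linear (*s) (*s) g"
  shows "Vector_Spaces.linear (map_scale (*s)) (*) (\<lambda>f. fval w (commutator f g))"
    and "Vector_Spaces.linear (map_scale (*s)) (*) (\<lambda>f. fval w (commutator g f))"
proof -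
  have "commutator (f + f') g = commutator f g + commutator f' g"
    "commutator g (f + f') = commutator g f + commutator g f'"
    "commutator (map_scale (*s) c f) g = map_scale (*s) c (commutator f g)"
    "commutator g (map_scale (*s) c f) = map_scale (*s) c (commutator g f)" for f f' c
    by (auto simp: commutator_def map_scale_def fun_eq_iff g3_linearD[OF assms]
        vec.scale_right_diff_distrib)
  then show "Vector_Spaces.linear (map_scale (*s)) (*) (\<lambda>f. fval w (commutator f g))"
    "Vector_Spaces.linear (map_scale (*s)) (*) (\<lambda>f. fval w (commutator g f))"
    using linear_fval[of w] by (simp_all add: Vector_Spaces.linear_iff)
qed

text \<open>Almost-inner derivations are closed under commutators, so only the inner forms need
  checking. Their values on commutators are bilinear, which reduces the claim to pairs from the
  basis.\<close>

lemma commutator_complement: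
  assumes f: "f \<in> complement" and g: "g \<in> complement"
  shows "commutator f g \<in> complement"
proof -
  let ?B = "snd ` set (family complement_family)"
  have "fval w (commutator f g) = 0" if w: "(w, i) \<in> set inner_indices" for w i
  proof -
    have "(w, sad i) \<in> set all_families"
      using w by (force simp: all_families_def inner_family_def)
    then have valid: "valid_form w" by (rule valid_form_all)
    have check: "derivation_check M" if M: "M \<in> snd ` set complement_family" for M
    proof -
      obtain w where "(w, M) \<in> set complement_family" using M by auto
      then show ?thesis by (intro derivation_check_all[of w]) (simp add: all_families_def)
    qed
    have half: "fval w (commutator (lin M) (lin N)) = 0"
      if "list_all (\<lambda>(w, _). form_value w (scommutator M N) = 0) inner_indices"
        "M \<in> snd ` set complement_family" "N \<in> snd ` set complement_family" for M N
      using that w by (subst fval_commutator_lin) (auto simp: valid check list_all_iff)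
    have swap: "fval w (commutator h k) = - fval w (commutator k h)" for h k
    proof -
      have "commutator h k = map_scale (*s) (- 1) (commutator k h)"
        by (auto simp: commutator_def map_scale_def)
      then show ?thesis by (simp only: M.linear_functional[OF linear_fval]) simp
    qed
    have basis: "fval w (commutator b c) = 0" if bc: "b \<in> ?B" "c \<in> ?B" for b c
    proof -
      obtain M N where MN: "b = lin M" "c = lin N" "M \<in> snd ` set complement_family"
        "N \<in> snd ` set complement_family"
        using bc by (force simp: family_def)
      then consider "M = N"
        | "list_all (\<lambda>(w, _). form_value w (scommutator M N) = 0) inner_indices"
        | "list_all (\<lambda>(w, _). form_value w (scommutator N M) = 0) inner_indices"
        using sorted_wrt_pairs[OF scommutator_check, of M N] by auto
      then show ?thesis
      proof cases
        case 1
        have "commutator c c = 0" by (simp add: commutator_def)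
        then show ?thesis using 1 MN by (simp add: M.linear_functional[OF linear_fval])
      next
        case 2
        then show ?thesis using half MN by simp
      next
        case 3
        then have "fval w (commutator c b) = 0" using half MN by simp
        then show ?thesis by (simp add: swap[of b c])
      qed
    qed
    have lin: "Vector_Spaces.linear (*s) (*s) h" if "h \<in> complement" for h
      using that by (simp add: complement_def AID_def Der_def)
    \<comment> \<open>The second argument is extended to the span first, then the first
      argument.\<close>
    have "fval w (commutator b g) = 0" if "b \<in> ?B" for b
    proof (rule M.functional_zero_on_span[OF commutator_functional(2)])
      show "Vector_Spaces.linear (*s) (*s) b" using that complement_family_subset lin by blast
      show "g \<in> M.span ?B" using g by (simp only: complement_basis(1))
      show "\<And>c. c \<in> ?B \<Longrightarrow> fval w (commutator b c) = 0" using that by (rule basis)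
    qed
    then show ?thesis
      using f by (intro M.functional_zero_on_span[OF commutator_functional(1)[OF lin[OF g]], of f ?B])
        (simp_all only: complement_basis(1))
  qed
  moreover have "commutator f g \<in> AID (*s) g3_bracket"
    using f g L.lie_subalgebra_AID by (simp add: complement_def lie_subalgebra_def)
  ultimately show ?thesis by (auto simp: complement_def)
qed

text \<open>By \<open>triangular_approx\<close>, subtracting a suitable inner derivation makes all
  twelve inner forms vanish.\<close>

lemma AID_eq_sum: "AID (*s) g3_bracket = {f + g | f g. f \<in> Inn g3_bracket \<and> g \<in> complement}"
proof (intro equalityI subsetI)
  fix \<delta> assume \<delta>: "\<delta> \<in> AID (*s) g3_bracket"
  obtain f where f: "f \<in> M.span (snd ` set (family inner_family))"
    "\<forall>p\<in>set (family inner_family). fst p (\<delta> - f) = 0"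
    using M.triangular_approx[OF triangular_families(2), of \<delta>] family_linear by blast
  have "fval w (\<delta> - f) = 0" if "(w, i) \<in> set inner_indices" for w i
  proof -
    have "(fval w, lin (sad i)) \<in> set (family inner_family)"
      using that by (force simp: family_def inner_family_def)
    then show ?thesis using f(2) by fastforce
  qed
  moreover have "f \<in> Inn g3_bracket" using f(1) by (simp only: Inn_eq_span)
  ultimately have "\<delta> - f \<in> complement" "f \<in> Inn g3_bracket"
    using \<delta> L.Inn_subset_AID M.subspace_diff[OF subspace_AID] by (auto simp: complement_def)
  moreover have "\<delta> = f + (\<delta> - f)" by simp
  ultimately show "\<delta> \<in> {f + g | f g. f \<in> Inn g3_bracket \<and> g \<in> complement}" by blast
next
  fix \<delta> assume "\<delta> \<in> {f + g | f g. f \<in> Inn g3_bracket \<and> g \<in> complement}"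
  then show "\<delta> \<in> AID (*s) g3_bracket"
    using L.Inn_subset_AID M.subspace_add[OF subspace_AID] by (auto simp: complement_def)
qed

text \<open>The inner forms separate inner derivations by triangularity, and all of them vanish on
  the complement.\<close>

lemma Inn_Int_complement: "Inn g3_bracket \<inter> complement = {0}"
proof -
  have "f = 0" if "f \<in> Inn g3_bracket" "f \<in> complement" for f
  proof (rule M.triangular_span_zero[OF triangular_families(2) family_linear])
    show "f \<in> M.span (snd ` set (family inner_family))" using that(1) by (simp only: Inn_eq_span)
    show "fst p f = 0" if "p \<in> set (family inner_family)" for p
      using that \<open>f \<in> complement\<close> by (auto simp: family_def inner_family_def complement_def)
  qed
  moreover have "0 \<in> Inn g3_bracket"
    using M.subspace_0 L.lie_subalgebra_Inn unfolding lie_subalgebra_def by blast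
  ultimately show ?thesis using M.subspace_0[OF subspace_complement] by blast
qed

section \<open>The maps \<open>d1\<close>, \<open>d2\<close> and the non-abelian quotient\<close>

lemma d1_eq: "d1 = lin (snd (complement_family ! 0))"
  and d2_eq: "d2 = lin (snd (complement_family ! 3))"
proof -
  have *: "linear_extension (table_lookup (map (\<lambda>(i, u). (i, sv u)) M)) = lin M" for M
    unfolding lin_def
  proof (rule arg_cong[of _ _ linear_extension], rule ext)
    show "table_lookup (map (\<lambda>(i, u). (i, sv u)) M) i = sv (lookup M i)" for i
      by (induction M) (auto simp: table_lookup_def lookup_def)
  qed
  show "d1 = lin (snd (complement_family ! 0))"
    by (simp add: d1_def complement_family_def flip: *)
  show "d2 = lin (snd (complement_family ! 3))"
    by (simp add: d2_def complement_family_def flip: *)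
qed

lemma d_complement: "d1 \<in> complement" "d2 \<in> complement"
proof -
  have "lin (snd (complement_family ! n)) \<in> complement" if "n < 21" for n
  proof -
    have "length complement_family = 21" by (simp add: complement_family_def)
    then have "complement_family ! n \<in> set complement_family" using that by simp
    then have "lin (snd (complement_family ! n)) \<in> snd ` set (family complement_family)"
      unfolding family_def by (force simp: case_prod_unfold)
    then show ?thesis using complement_family_subset by blast
  qed
  then show "d1 \<in> complement" "d2 \<in> complement" by (simp_all add: d1_eq d2_eq)
qed

lemma commutator_d1_d2: "commutator d1 d2 \<noteq> 0"
proof
  assume "commutator d1 d2 = 0"
  \<comment> \<open>Already v_2 detects the commutator: d_1 d_2 v_2 = d_1 v_10 = v_14, whereas d_2
    d_1 v_2 = d_2 v_7 = v_13.\<close>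
  then have "co (commutator d1 d2 (bv 2)) 14 = 0" by simp
  moreover have "commutator d1 d2 (bv 2) = bv 14 - bv 13"
    by (simp add: commutator_def d1_def d2_def linear_extension_bv table_lookup_def)
  ultimately show False by (simp add: co_bv)
qed

text \<open>If the quotient were abelian, the commutator of \<open>d1\<close> and \<open>d2\<close>
  would be inner. It also lies in the complement, which is a subalgebra meeting \<open>Inn\<close>
  trivially, so it would be zero.\<close>

lemma not_quotient_abelian: "\<not> quotient_abelian commutator (AID (*s) g3_bracket) (Inn g3_bracket)"
proof
  assume abelian: "quotient_abelian commutator (AID (*s) g3_bracket) (Inn g3_bracket)"
  have AID: "d1 \<in> AID (*s) g3_bracket" "d2 \<in> AID (*s) g3_bracket"
    using d_complement by (simp_all add: complement_def)
  then have "coset (Inn g3_bracket) (commutator d1 d2) = coset (Inn g3_bracket) 0"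
    using abelian L.quotient_bracket_coset[of d1 d2]
    by (simp add: quotient_abelian_def quotient_carrier_def AID_def)
  \<comment> \<open>A coset contains its representative because 0 is inner.\<close>
  moreover have "commutator d1 d2 \<in> coset (Inn g3_bracket) (commutator d1 d2)"
    using Inn_Int_complement by (force simp: coset_def)
  ultimately have "commutator d1 d2 \<in> Inn g3_bracket" by (auto simp: coset_def)
  then have "commutator d1 d2 = 0"
    using Inn_Int_complement commutator_complement[OF d_complement] by blast
  with commutator_d1_d2 show False by contradiction
qed

theorem mainTheorem1:
  shows "lie_algebra (*s) g3_bracket
    \<and> vector_space.dim (map_scale (*s)) (Der (*s) g3_bracket) = 45
    \<and> vector_space.dim (map_scale (*s)) (Inn g3_bracket) = 12
    \<and> (\<exists>U. lie_subalgebra (map_scale (*s)) commutator U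
          \<and> vector_space.dim (map_scale (*s)) U = 21
          \<and> AID (*s) g3_bracket = {f + g | f g. f \<in> Inn g3_bracket \<and> g \<in> U}
          \<and> Inn g3_bracket \<inter> U = {0}
          \<and> d1 \<in> U \<and> d2 \<in> U)
    \<and> commutator d1 d2 \<noteq> 0
    \<and> \<not> quotient_abelian commutator (AID (*s) g3_bracket) (Inn g3_bracket)
    \<and> CHAR(F3) > 0
    \<and> (\<exists>(scl :: F3 \<Rightarrow> g3 \<Rightarrow> g3) bracket B.
          lie_algebra scl bracket \<and> finite_dimensional_vector_space scl B
          \<and> \<not> quotient_abelian commutator (AID scl bracket) (Inn bracket))"
proof (intro conjI)
  show "\<exists>U. lie_subalgebra (map_scale (*s)) commutator U
      \<and> vector_space.dim (map_scale (*s)) U = 21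
      \<and> AID (*s) g3_bracket = {f + g | f g. f \<in> Inn g3_bracket \<and> g \<in> U}
      \<and> Inn g3_bracket \<inter> U = {0} \<and> d1 \<in> U \<and> d2 \<in> U"
    using subspace_complement commutator_complement complement_basis(2) AID_eq_sum
      Inn_Int_complement d_complement
    by (intro exI[of _ complement]) (simp add: lie_subalgebra_def)
  show "CHAR(F3) > 0" by (rule finite_imp_CHAR_pos) simp
  show "\<exists>(scl :: F3 \<Rightarrow> g3 \<Rightarrow> g3) bracket B.
      lie_algebra scl bracket \<and> finite_dimensional_vector_space scl B
      \<and> \<not> quotient_abelian commutator (AID scl bracket) (Inn bracket)"
    using lie_algebra_g3 vec.finite_dimensional_vector_space_axioms not_quotient_abelian by blast
qed (fact lie_algebra_g3 dim_Der dim_Inn commutator_d1_d2 not_quotient_abelian)+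

end
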